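(* Let $n>2k\ge 6$ and let $\mathcal F\subseteq\binom{[n]}{k}$ be an intersecting family. Let $\gamma_0=0$ and let $\gamma_1<\gamma_2<\dots<\gamma_m$ be all resistant numbers (with respect to $n,k$) in increasing order. Suppose that $\gamma_{l-1}<\gamma(\mathcal F)\le \gamma_l$ for some $l\in[m]$, and let $S_{\gamma_l}=\{a_1<a_2<\dots<a_{s_a}\}$ be the set associated with $\gamma_l$ as in the context. Then $$|\mathcal F|\le \binom{n-a_1}{n-k}+\binom{n-a_2}{n-k-1}+\dots+\binom{n-a_{s_a}}{n-k-s_a+1}+\gamma_l=\sum_{i=1}^{s_a}\binom{n-a_i}{n-k-i+1}+\gamma_l .$$ Moreover, the right-hand side of this inequality (viewed as a function of $l\in[m]$) is strictly decreasing in $l$, and the bound is sharp: for each $l\in[m]$ there exists an intersecting family $\mathcal F\subseteq\binom{[n]}{k}$ with $\gamma(\mathcal F)=\gamma_l$ attaining equality.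
   Context: For $\mathcal F\subseteq\binom{[n]}{k}$ and $i\in[n]$, the degree of $i$ is the number of sets of $\mathcal F$ containing $i$; $\Delta(\mathcal F)$ is the maximal degree, and the diversity is $\gamma(\mathcal F)=|\mathcal F|-\Delta(\mathcal F)$. A family is intersecting if any two of its sets intersect. For integers $a\le b$, $[a,b]=\{a,\dots,b\}$. Cascade form: every positive integer $\gamma$ has a unique representation $\gamma=\binom{c_1}{n-k-1}+\binom{c_2}{n-k-2}+\dots+\binom{c_{s}}{n-k-s}$ with $c_1>c_2>\dots>c_s\ge n-k-s\ge 1$ (the $(n-k-1)$-cascade form). Write $c_i=n-b_i$, so $\gamma=\sum_{i=1}^{s_b}\binom{n-b_i}{n-k-i}$ with $s_b=s$ and $b_1<b_2<\dots<b_{s_b}$. Define $T_\gamma=\{b_1,\dots,b_{s_b}\}$ and $S_\gamma=\{b_{s_b}\}\cup([2,b_{s_b}]\setminus T_\gamma)$, and write $S_\gamma=\{a_1<\dots<a_{s_a}\}$ (so $a_{s_a}=b_{s_b}$, $s_a=|S_\gamma|$). A positive integer $\gamma$ is called resistant if (1) $s_a=|S_\gamma|\le k$ and $s_b=|T_\gamma|\le k-1$, and (2) $b_i>2i+2$ for each $i\in[s_b]$; in addition, by convention the number $\binom{n-4}{k-3}$ is declared resistant. (The paper notes that the smallest resistant number is $1$ and the largest is $\binom{n-4}{k-3}$.) *)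

theory Defs
  imports Main
begin

section \<open>Families of sets\<close>

definition k_subsets :: "nat \<Rightarrow> nat \<Rightarrow> nat set set" where
  "k_subsets n k = {A. A \<subseteq> {1..n} \<and> card A = k}"

definition intersecting :: "nat set set \<Rightarrow> bool" where
  "intersecting F \<longleftrightarrow> (\<forall>A\<in>F. \<forall>B\<in>F. A \<inter> B \<noteq> {})"

definition degree :: "nat set set \<Rightarrow> nat \<Rightarrow> nat" where
  "degree F i = card {A \<in> F. i \<in> A}"

definition max_degree :: "nat \<Rightarrow> nat set set \<Rightarrow> nat" where
  "max_degree n F = Max (degree F ` {1..n})"

definition diversity :: "nat \<Rightarrow> nat set set \<Rightarrow> nat" where
  "diversity n F = card F - max_degree n F"


section \<open>Cascade forms\<close>

text \<open>
  The list \<open>[c\<^sub>1, \<dots>, c\<^sub>s]\<close> is the \<open>t\<close>-cascade form of \<open>g\<close>: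
  \<open>g = (c\<^sub>1 choose t) + (c\<^sub>2 choose (t - 1)) + \<dots> + (c\<^sub>s choose (t - s + 1))\<close>
  with \<open>c\<^sub>1 > \<dots> > c\<^sub>s \<ge> t - s + 1 \<ge> 1\<close>. List positions start at \<open>0\<close>,
  so \<open>c\<^sub>i\<close> is \<open>cs ! (i - 1)\<close>.
\<close>

definition is_cascade :: "nat \<Rightarrow> nat \<Rightarrow> nat list \<Rightarrow> bool" where
  "is_cascade t g cs \<longleftrightarrow>
     cs \<noteq> [] \<and> sorted_wrt (>) cs \<and> length cs \<le> t \<and> last cs \<ge> t + 1 - length cs \<and>
     g = (\<Sum>i<length cs. (cs ! i) choose (t - i))"

definition cascade :: "nat \<Rightarrow> nat \<Rightarrow> nat list" where
  "cascade t g = (THE cs. is_cascade t g cs)"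

lemma is_cascade_Nil [simp]: "\<not> is_cascade t g []"
  by (simp add: is_cascade_def)

lemma is_cascade_single: "is_cascade t g [c] \<longleftrightarrow> 1 \<le> t \<and> t \<le> c \<and> g = c choose t"
  by (auto simp: is_cascade_def)

lemma is_cascade_Cons2:
  "is_cascade t g (c # d # ds) \<longleftrightarrow>
     1 \<le> t \<and> d < c \<and> (\<exists>h. is_cascade (t - 1) h (d # ds) \<and> g = (c choose t) + h)"
proof -
  have "(\<Sum>i<length (c # d # ds). ((c # d # ds) ! i) choose (t - i)) =
    (c choose t) + (\<Sum>i<length (d # ds). ((d # ds) ! i) choose (t - 1 - i))"
    by (subst list.size(4), unfold add_Suc_right add_0_right, subst sum.lessThan_Suc_shift) simp
  moreover have "sorted_wrt (>) (c # d # ds) \<longleftrightarrow> d < c \<and> sorted_wrt (>) (d # ds)"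
    by auto
  ultimately show ?thesis
    unfolding is_cascade_def by (auto simp del: sum.lessThan_Suc)
qed

lemma is_cascade_hd_bounds:
  "is_cascade t g cs \<Longrightarrow>
     1 \<le> t \<and> t \<le> hd cs \<and> hd cs choose t \<le> g \<and> g < Suc (hd cs) choose t"
proof (induction cs arbitrary: t g)
  case Nil
  then show ?case by simp
next
  case (Cons c ds)
  show ?case
  proof (cases ds)
    case Nil
    with Cons.prems have *: "1 \<le> t" "t \<le> c" "g = c choose t"
      by (auto simp: is_cascade_single)
    obtain u where "t = Suc u" using *(1) by (cases t) auto
    with * Nil show ?thesis by (auto simp: zero_less_binomial_iff)
  next
    case (Cons d es)
    with Cons.prems obtain h where h: "1 \<le> t" "d < c" "is_cascade (t - 1) h ds"
      "g = (c choose t) + h"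
      by (auto simp: is_cascade_Cons2)
    have IH: "1 \<le> t - 1" "t - 1 \<le> d" "h < Suc d choose (t - 1)"
      using Cons.IH[OF h(3)] Cons by auto
    obtain u where u: "t = Suc u" using h(1) by (cases t) auto
    have "Suc d choose u \<le> c choose u"
      using h(2) by (intro binomial_right_mono) auto
    with IH h u show ?thesis by auto
  qed
qed

lemma is_cascade_unique: "is_cascade t g cs \<Longrightarrow> is_cascade t g cs' \<Longrightarrow> cs = cs'"
proof (induction cs arbitrary: t g cs')
  case Nil
  then show ?case by simp
next
  case (Cons c ds)
  obtain c' ds' where cs': "cs' = c' # ds'"
    using Cons.prems(2) by (cases cs') auto
  have b: "c choose t \<le> g" "g < Suc c choose t" "c' choose t \<le> g" "g < Suc c' choose t"
    using is_cascade_hd_bounds[OF Cons.prems(1)] is_cascade_hd_bounds[OF Cons.prems(2)] cs'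
    by auto
  have eq: "c = c'"
  proof (rule ccontr)
    assume "c \<noteq> c'"
    then consider "Suc c \<le> c'" | "Suc c' \<le> c" by linarith
    then show False
    proof cases
      case 1
      then have "Suc c choose t \<le> c' choose t" by (rule binomial_right_mono)
      with b show False by simp
    next
      case 2
      then have "Suc c' choose t \<le> c choose t" by (rule binomial_right_mono)
      with b show False by simp
    qed
  qed
  have pos: "0 < h" if "is_cascade u h (x # xs)" for u h x xs
    using is_cascade_hd_bounds[OF that] by (auto intro: order.strict_trans2[OF zero_less_binomial])
  show ?case
  proof (cases ds)
    case Nil
    then have "g = c choose t" using Cons.prems(1) by (simp add: is_cascade_single)
    then have "ds' = []"
      using Cons.prems(2) cs' eq pos by (cases ds') (auto simp: is_cascade_Cons2)
    with Nil cs' eq show ?thesis by simp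
  next
    case ds: (Cons d es)
    then obtain h where h: "is_cascade (t - 1) h ds" "g = (c choose t) + h"
      using Cons.prems(1) by (auto simp: is_cascade_Cons2)
    obtain d' es' where ds': "ds' = d' # es'"
      using Cons.prems(2) cs' eq h ds pos by (cases ds') (auto simp: is_cascade_single)
    have "is_cascade (t - 1) h ds'"
      using Cons.prems(2) cs' ds' eq h(2) by (auto simp: is_cascade_Cons2)
    with Cons.IH[OF h(1)] cs' eq show ?thesis by simp
  qed
qed

lemma is_cascade_exists: "1 \<le> t \<Longrightarrow> 1 \<le> g \<Longrightarrow> \<exists>cs. is_cascade t g cs"
proof (induction t arbitrary: g)
  case 0
  then show ?case by simp
next
  case (Suc t)
  define P where "P c \<longleftrightarrow> c choose Suc t \<le> g" for c
  have bound: "c \<le> Suc t + g" if "P c" for c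
  proof (rule ccontr)
    assume "\<not> c \<le> Suc t + g"
    then have "Suc t + g choose Suc t \<le> c choose Suc t" by (intro binomial_right_mono) auto
    moreover have "m < Suc t + m choose Suc t" for m
    proof (induction m)
      case (Suc m)
      have "0 < Suc (t + m) choose t" by (subst zero_less_binomial_iff) simp
      moreover have "Suc t + Suc m choose Suc t = (Suc (t + m) choose t) + (Suc t + m choose Suc t)"
        by simp
      ultimately show ?case using Suc.IH by linarith
    qed simp
    from this[of g] have "g < Suc t + g choose Suc t" .
    ultimately show False using that by (simp add: P_def)
  qed
  define c where "c = (GREATEST c. P c)"
  have PSt: "P (Suc t)" using Suc.prems by (simp add: P_def)
  have Pc: "P c" unfolding c_def by (rule GreatestI_nat[where P = P, OF PSt]) (use bound in auto)
  have ge: "Suc t \<le> c" unfolding c_def by (rule Greatest_le_nat[where P = P, OF PSt]) (use bound in auto)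
  have "\<not> P (Suc c)"
  proof
    assume "P (Suc c)"
    then have "Suc c \<le> c" unfolding c_def by (rule Greatest_le_nat[where P = P]) (use bound in auto)
    then show False by simp
  qed
  then have up: "g < Suc c choose Suc t" by (simp add: P_def)
  show ?case
  proof (cases "g = c choose Suc t")
    case True
    then have "is_cascade (Suc t) g [c]" using ge by (simp add: is_cascade_single)
    then show ?thesis ..
  next
    case False
    define h where "h = g - (c choose Suc t)"
    have h: "g = (c choose Suc t) + h" "1 \<le> h" "h < c choose t"
      using False Pc up by (auto simp: h_def P_def)
    have "1 \<le> t" using h by (cases t) auto
    from Suc.IH[OF this h(2)] obtain cs where cs: "is_cascade t h cs" by blast
    then obtain d ds where d: "cs = d # ds" by (cases cs) auto
    have "d < c"
    proof (rule ccontr)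
      assume "\<not> d < c"
      then have "c choose t \<le> d choose t" by (intro binomial_right_mono) auto
      with is_cascade_hd_bounds[OF cs] d h(3) show False by simp
    qed
    then have "is_cascade (Suc t) g (c # cs)"
      using cs h(1) d by (auto simp: is_cascade_Cons2)
    then show ?thesis ..
  qed
qed

lemma is_cascade_cascade:
  assumes "1 \<le> t" "1 \<le> g"
  shows "is_cascade t g (cascade t g)"
proof -
  have "\<exists>!cs. is_cascade t g cs"
    using is_cascade_exists[OF assms] is_cascade_unique by blast
  then show ?thesis unfolding cascade_def by (rule theI')
qed


section \<open>Resistant numbers\<close>

text \<open>
  \<open>b_list n k g = [b\<^sub>1, \<dots>, b\<^sub>s]\<close> where \<open>c\<^sub>i = n - b\<^sub>i\<close>. If some \<open>c\<^sub>i > n\<close>, truncated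
  subtraction gives \<open>b\<^sub>i = 0\<close> instead of a negative number; either way
  \<open>b\<^sub>i > 2 * i + 2\<close> fails, so the set of resistant numbers is not affected.
\<close>

definition b_list :: "nat \<Rightarrow> nat \<Rightarrow> nat \<Rightarrow> nat list" where
  "b_list n k g = map (\<lambda>c. n - c) (cascade (n - k - 1) g)"

definition T_set :: "nat \<Rightarrow> nat \<Rightarrow> nat \<Rightarrow> nat set" where
  "T_set n k g = set (b_list n k g)"

definition S_set :: "nat \<Rightarrow> nat \<Rightarrow> nat \<Rightarrow> nat set" where
  "S_set n k g = {last (b_list n k g)} \<union> ({2..last (b_list n k g)} - T_set n k g)"

definition a_list :: "nat \<Rightarrow> nat \<Rightarrow> nat \<Rightarrow> nat list" where
  "a_list n k g = sorted_list_of_set (S_set n k g)"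

definition resistant :: "nat \<Rightarrow> nat \<Rightarrow> nat \<Rightarrow> bool" where
  "resistant n k g \<longleftrightarrow> g > 0 \<and>
     ((card (S_set n k g) \<le> k \<and> card (T_set n k g) \<le> k - 1 \<and>
       (\<forall>i\<in>{1..length (b_list n k g)}. b_list n k g ! (i - 1) > 2 * i + 2))
      \<or> g = (n - 4) choose (k - 3))"

lemma finite_resistant:
  assumes "k + 2 \<le> n"
  shows "finite {g. resistant n k g}"
proof (rule finite_subset)
  show "{g. resistant n k g} \<subseteq> {..(Suc n choose (n - k - 1)) + ((n - 4) choose (k - 3))}"
  proof safe
    fix g assume r: "resistant n k g"
    show "g \<le> (Suc n choose (n - k - 1)) + ((n - 4) choose (k - 3))"
    proof (cases "g = (n - 4) choose (k - 3)")
      case False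
      define cs where "cs = cascade (n - k - 1) g"
      have cs: "is_cascade (n - k - 1) g cs"
        unfolding cs_def by (rule is_cascade_cascade) (use assms r in \<open>auto simp: resistant_def\<close>)
      then obtain c ds where c: "cs = c # ds" by (cases cs) auto
      have b: "b_list n k g = (n - c) # map (\<lambda>c. n - c) ds"
        using c by (simp add: b_list_def cs_def)
      have "\<forall>i\<in>{1..length (b_list n k g)}. b_list n k g ! (i - 1) > 2 * i + 2"
        using r False unfolding resistant_def by blast
      then have "n - c > 4" using b by (auto dest: bspec[where x = 1])
      then have "Suc c choose (n - k - 1) \<le> Suc n choose (n - k - 1)"
        by (intro binomial_right_mono) auto
      with is_cascade_hd_bounds[OF cs] c show ?thesis by simp
    qed simp
  qed
qed simp

definition size_bound :: "nat \<Rightarrow> nat \<Rightarrow> nat \<Rightarrow> nat" where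
  "size_bound n k g =
     (\<Sum>i = 1..card (S_set n k g). (n - a_list n k g ! (i - 1)) choose (n - k - i + 1)) + g"

end

theory Submission
  imports Defs "HOL.Binomial_Plus"
begin

text \<open>
  Let \<open>e\<close> have maximal degree in \<open>F\<close>. The sets through \<open>e\<close>, with \<open>e\<close> deleted, and the \<open>g = \<gamma>(F)\<close> sets
  avoiding \<open>e\<close> are cross-intersecting families of \<open>(k - 1)\<close>-sets and \<open>k\<close>-sets. By Kruskal-Katona
  the worst case is lexicographic, so \<open>|F| \<le> G(g)\<close>, where \<open>G(g)\<close> is the total size of the
  lexicographic pair.

  Deciding the elements of the ground set one at a time, the lexicographic pair traverses
  states \<open>(M, a, d)\<close>: subsets of sizes \<open>a\<close> and \<open>d\<close> of an \<open>M\<close>-set remain to be chosen. If a state with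
  \<open>a = d\<close> is reached, the two remaining families together have at most \<open>M choose d\<close> members, which
  is also the total when all \<open>d\<close>-sets are taken and no \<open>a\<close>-set. Raising \<open>g\<close> to the end of this block
  therefore does not decrease \<open>G\<close>, and no number in the block is resistant. Repeating this leads
  from \<open>g\<close> to the next resistant number. Along resistant numbers \<open>a > d\<close> throughout, and there
  binomial monotonicity makes \<open>G\<close> strictly decreasing.
\<close>

section \<open>Comparing binomial coefficients in one row\<close>

text \<open>Either \<open>b\<close> or its mirror image \<open>N - b\<close> lies in the increasing
  half of the row, and both are at least \<open>a\<close>.\<close>

lemma binomial_le_of_sum_le:
  fixes a b N :: nat
  assumes "a \<le> b" "a + b \<le> N"
  shows "N choose a \<le> N choose b"
proof (cases "2 * b \<le> N")
  case True
  then show ?thesis using assms by (intro binomial_mono) auto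
next
  case False
  have "N choose a \<le> N choose (N - b)" using assms False by (intro binomial_mono) auto
  then show ?thesis using assms binomial_symmetric[of b N] by simp
qed

lemma binomial_less_of_sum_less:
  fixes a b N :: nat
  assumes "a < b" "a + b < N"
  shows "N choose a < N choose b"
proof (cases "2 * b \<le> N")
  case True
  then show ?thesis using assms by (intro binomial_strict_mono) auto
next
  case False
  have "N choose a < N choose (N - b)" using assms False by (intro binomial_strict_mono) auto
  then show ?thesis using assms binomial_symmetric[of b N] by simp
qed

section \<open>Cascades with shifted lower indices\<close>

text \<open>For the entries of a \<open>t\<close>-cascade and \<open>r < t\<close> this is the
  Kruskal-Katona lower bound for the \<open>r\<close>-shadow. The entry that meets lower index 0
  counts once, and the entries after it give no new \<open>r\<close>-sets.\<close>

fun cascade_sum :: "nat \<Rightarrow> nat list \<Rightarrow> nat" where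
  "cascade_sum r [] = 0"
| "cascade_sum 0 (c # cs) = 1"
| "cascade_sum (Suc r) (c # cs) = (c choose Suc r) + cascade_sum r cs"

fun cascade_below :: "nat \<Rightarrow> nat \<Rightarrow> nat list \<Rightarrow> bool" where
  "cascade_below t M [] = True"
| "cascade_below t M (c # cs) = (1 \<le> t \<and> t \<le> c \<and> c < M \<and> cascade_below (t - 1) c cs)"

lemma cascade_below_mono: "cascade_below t M cs \<Longrightarrow> M \<le> M' \<Longrightarrow> cascade_below t M' cs"
  by (cases cs) auto

lemma cascade_below_length: "cascade_below t M cs \<Longrightarrow> length cs \<le> t"
  by (induction t M cs rule: cascade_below.induct) auto

lemma cascade_below_pos: "cascade_below t M cs \<Longrightarrow> c \<in> set cs \<Longrightarrow> 1 \<le> c"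
  by (induction t M cs rule: cascade_below.induct) auto

text \<open>An entry and its lower index drop together, so the inequality between them survives.
  Only a \<open>t\<close>-th entry, whose lower index would become 0, has to be cut.\<close>

lemma cascade_below_map_pred:
  "cascade_below t M cs \<Longrightarrow> cascade_below (t - 1) (M - 1) (map (\<lambda>c. c - 1) (take (t - 1) cs))"
proof (induction t M cs rule: cascade_below.induct)
  case (2 t M c cs)
  show ?case
  proof (cases "t - 1")
    case (Suc u)
    then have t: "t = Suc (Suc u)" by simp
    then have "cascade_below u (c - 1) (map (\<lambda>c. c - 1) (take u cs))"
      using 2 by simp
    then show ?thesis using 2(2) t by auto
  qed simp
qed simp

lemma is_cascade_cascade_below:
  "is_cascade t g cs \<Longrightarrow> hd cs < M \<Longrightarrow> cascade_below t M cs \<and> cascade_sum t cs = g"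
proof (induction cs arbitrary: t g M)
  case (Cons c cs)
  show ?case
  proof (cases cs)
    case Nil
    then show ?thesis using Cons.prems by (cases t) (auto simp: is_cascade_single)
  next
    case (Cons d ds)
    obtain h where h: "is_cascade (t - 1) h cs" "g = (c choose t) + h" "1 \<le> t" "d < c"
      using Cons.prems(1) Cons by (auto simp: is_cascade_Cons2)
    have "t \<le> c" using is_cascade_hd_bounds[OF Cons.prems(1)] by simp
    then show ?thesis using Cons.IH[OF h(1), of c] h Cons Cons.prems(2) by (cases t) auto
  qed
qed simp

lemma is_cascade_hd_less:
  assumes "is_cascade t g cs" "g < M choose t"
  shows "hd cs < M"
proof (rule ccontr)
  assume "\<not> hd cs < M"
  then have "M choose t \<le> hd cs choose t" by (intro binomial_right_mono) simp
  then show False using is_cascade_hd_bounds[OF assms(1)] assms(2) by simp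
qed

lemma cascade_sum_take: "r < m \<Longrightarrow> cascade_sum r (take m cs) = cascade_sum r cs"
proof (induction r cs arbitrary: m rule: cascade_sum.induct)
  case (2 c cs)
  then show ?case by (cases m) auto
next
  case (3 r c cs)
  then show ?case by (cases m) auto
qed simp

lemma cascade_sum_take_le: "cascade_sum r (take m cs) \<le> cascade_sum r cs"
proof (induction r cs arbitrary: m rule: cascade_sum.induct)
  case (2 c cs)
  then show ?case by (cases m) auto
next
  case (3 r c cs)
  then show ?case by (cases m) auto
qed simp

lemma cascade_sum_0: "cascade_sum 0 cs = (if cs = [] then 0 else 1)"
  by (cases cs) auto

text \<open>Pascal's rule in each term. It mirrors the split of a family by whether its members
  contain a fixed element.\<close>

lemma cascade_sum_Suc_pred:
  "(\<forall>c\<in>set cs. 1 \<le> c) \<Longrightarrow>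
   cascade_sum (Suc r) cs =
     cascade_sum (Suc r) (map (\<lambda>c. c - 1) cs) + cascade_sum r (map (\<lambda>c. c - 1) cs)"
proof (induction cs arbitrary: r)
  case (Cons c cs)
  obtain b where b: "c = Suc b" using Cons.prems by (cases c) auto
  show ?case
  proof (cases r)
    case 0
    then show ?thesis by (simp add: b cascade_sum_0)
  next
    case (Suc q)
    then show ?thesis using Cons by (simp add: b)
  qed
qed simp

text \<open>The bound \<open>Suc t\<close> forces the entries to be \<open>t\<close>,
  \<open>t - 1\<close> and so on, so each of the at most \<open>t\<close> terms is at most 1 after
  lowering.\<close>

lemma cascade_sum_degenerate:
  "1 \<le> t \<Longrightarrow> cascade_below t (Suc t) cs \<Longrightarrow> cascade_sum (t - 1) (map (\<lambda>c. c - 1) cs) \<le> t"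
proof (induction t arbitrary: cs)
  case (Suc t)
  show ?case
  proof (cases cs)
    case (Cons c ds)
    then have c: "c = Suc t" "cascade_below t (Suc t) ds"
      using Suc.prems by (auto simp: le_less_Suc_eq)
    show ?thesis
    proof (cases t)
      case 0
      then show ?thesis using c Cons by simp
    next
      case (Suc u)
      then show ?thesis using Suc.IH[OF _ c(2)] c Cons by simp
    qed
  qed simp
qed simp

text \<open>Replaces the cascade obtained by lowering every entry, some of whose last terms may vanish,
  by a proper one.\<close>

lemma cascade_repair:
  assumes "cascade_below t (Suc M) cs" "1 \<le> t" "t < M"
  shows "\<exists>ds. cascade_below t M ds \<and>
     cascade_sum t ds \<le> cascade_sum t (map (\<lambda>c. c - 1) cs) + 1 \<and>
     cascade_sum (t - 1) (map (\<lambda>c. c - 1) cs) \<le> cascade_sum (t - 1) ds"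
  using assms
proof (induction cs arbitrary: t M)
  case Nil
  then show ?case by (intro exI[of _ "[]"]) simp
next
  case (Cons c cs)
  obtain u where u: "t = Suc u" using Cons.prems by (cases t) auto
  show ?case
  proof (cases "c = t")
    case True
    \<comment> \<open>All further entries are forced, and the witness \<open>[t]\<close> suffices:
      its \<open>t\<close>-sum is 1, the permitted excess, and its \<open>(t - 1)\<close>-sum is
      \<open>t\<close>.\<close>
    then have "cascade_below t (Suc t) (c # cs)" using Cons.prems by simp
    from cascade_sum_degenerate[OF Cons.prems(2) this]
    show ?thesis using Cons.prems
      by (intro exI[of _ "[t]"]) (cases u; simp add: u)
  next
    case False
    then obtain b where b: "c = Suc b" "t \<le> b" "b < M" using Cons.prems by (cases c) auto
    have cb: "cascade_below u (Suc b) cs" using Cons.prems b u by simp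
    show ?thesis
    proof (cases u)
      case 0
      then have "cs = []" using cascade_below_length[OF cb] by simp
      then show ?thesis using b u 0 by (intro exI[of _ "[b]"]) simp
    next
      case (Suc v)
      from Cons.IH[OF cb] obtain ds where "cascade_below u b ds"
        "cascade_sum u ds \<le> cascade_sum u (map (\<lambda>c. c - 1) cs) + 1"
        "cascade_sum (u - 1) (map (\<lambda>c. c - 1) cs) \<le> cascade_sum (u - 1) ds"
        using Suc u b by auto
      then show ?thesis using b u Suc by (intro exI[of _ "b # ds"]) simp
    qed
  qed
qed

lemma inj_on_insert_of_notin:
  assumes "\<And>B. B \<in> F \<Longrightarrow> e \<notin> B"
  shows "inj_on (insert e) F"
proof (rule inj_onI)
  fix A B assume "A \<in> F" "B \<in> F" "insert e A = insert e B"
  then show "A = B" using assms insert_ident by metis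
qed

section \<open>Shifting and the Kruskal-Katona theorem\<close>

definition shadow :: "nat \<Rightarrow> 'a set set \<Rightarrow> 'a set set" where
  "shadow r F = {D. card D = r \<and> (\<exists>A\<in>F. D \<subseteq> A)}"

text \<open>The compression that replaces \<open>j\<close> by \<open>e\<close>. A set whose image is
  already present stays in place, which keeps the map injective on \<open>F\<close>.\<close>

definition shift_map :: "'a \<Rightarrow> 'a \<Rightarrow> 'a set set \<Rightarrow> 'a set \<Rightarrow> 'a set" where
  "shift_map e j F A =
     (if j \<in> A \<and> e \<notin> A \<and> insert e (A - {j}) \<notin> F then insert e (A - {j}) else A)"

definition shift :: "'a \<Rightarrow> 'a \<Rightarrow> 'a set set \<Rightarrow> 'a set set" where
  "shift e j F = shift_map e j F ` F"

lemma inj_on_shift_map: "inj_on (shift_map e j F) F"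
  unfolding inj_on_def shift_map_def by (auto split: if_splits)

lemma card_shift: "card (shift e j F) = card F"
  unfolding shift_def by (rule card_image[OF inj_on_shift_map])

text \<open>The shift acts separately on each pair of sets that arise from one another by exchanging
  \<open>e\<close> and \<open>j\<close>.\<close>

lemma shift_iff:
  assumes "e \<noteq> j"
  shows "A \<in> shift e j F \<longleftrightarrow>
    (if e \<in> A \<and> j \<notin> A then A \<in> F \<or> insert j (A - {e}) \<in> F
     else if j \<in> A \<and> e \<notin> A then A \<in> F \<and> insert e (A - {j}) \<in> F
     else A \<in> F)" (is "_ = ?R")
proof
  assume "A \<in> shift e j F"
  then obtain B where B: "B \<in> F" "A = shift_map e j F B" by (auto simp: shift_def)
  show ?R
  proof (cases "j \<in> B \<and> e \<notin> B \<and> insert e (B - {j}) \<notin> F")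
    case True
    then have "A = insert e (B - {j})" using B by (simp add: shift_map_def)
    moreover then have "insert j (A - {e}) = B" using True assms by auto
    ultimately show ?thesis using B assms by auto
  next
    case False
    then have "A = B" using B by (auto simp: shift_map_def)
    then show ?thesis using False B by auto
  qed
next
  assume R: ?R
  show "A \<in> shift e j F"
  proof (cases "A \<in> F")
    case True
    then have "shift_map e j F A = A" using R by (auto simp: shift_map_def split: if_splits)
    then show ?thesis unfolding shift_def using True by force
  next
    case False
    then have eA: "e \<in> A" "j \<notin> A" "insert j (A - {e}) \<in> F" using R by (auto split: if_splits)
    then have "insert e (insert j (A - {e}) - {j}) = A" by auto
    then have "shift_map e j F (insert j (A - {e})) = A"
      using eA False assms by (simp add: shift_map_def)
    then show ?thesis unfolding shift_def using eA(3) by force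
  qed
qed

lemma card_swap:
  assumes "finite D" "x \<notin> D" "y \<in> D"
  shows "card (insert x (D - {y})) = card D"
  using assms card_Suc_Diff1[of D y] by simp

text \<open>Since shifting preserves cardinality, this inclusion shows that it does not enlarge the
  shadow.\<close>

lemma shadow_shift:
  assumes "e \<noteq> j" "\<And>A. A \<in> F \<Longrightarrow> finite A"
  shows "shadow r (shift e j F) \<subseteq> shift e j (shadow r F)"
proof
  fix D assume "D \<in> shadow r (shift e j F)"
  then obtain G where G: "card D = r" "D \<subseteq> G" "G \<in> shift e j F" by (auto simp: shadow_def)
  have finG: "finite G" using G(3) assms(2) by (auto simp: shift_def shift_map_def)
  have finD: "finite D" using finG G(2) finite_subset by blast
  have swap: "card (insert x (D - {y})) = r" if "x \<notin> D" "y \<in> D" for x y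
    using card_swap[OF finD that] G(1) by simp
  show "D \<in> shift e j (shadow r F)"
  proof (cases "G \<in> F")
    case True
    then have D: "D \<in> shadow r F" using G by (auto simp: shadow_def)
    \<comment> \<open>The exchanged copy of \<open>D\<close> must lie in the shadow as well. It is
      contained in \<open>G\<close> if \<open>e\<close> is in \<open>G\<close>, and otherwise in the
      exchanged copy of \<open>G\<close>, whose presence in \<open>F\<close> kept \<open>G\<close>
      from moving.\<close>
    have "insert e (D - {j}) \<in> shadow r F" if "j \<in> D" "e \<notin> D"
    proof (cases "e \<in> G")
      case True
      then have "insert e (D - {j}) \<subseteq> G" using G by auto
      then show ?thesis using swap that \<open>G \<in> F\<close> by (auto simp: shadow_def)
    next
      case False
      then have "insert e (G - {j}) \<in> F" using G that shift_iff[OF assms(1), of G F]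
        by (auto split: if_splits)
      moreover have "insert e (D - {j}) \<subseteq> insert e (G - {j})" using G by auto
      ultimately show ?thesis using swap that by (auto simp: shadow_def)
    qed
    then show ?thesis using D by (auto simp: shift_iff[OF assms(1)])
  next
    case False
    then have G': "e \<in> G" "j \<notin> G" "insert j (G - {e}) \<in> F"
      using G(3) shift_iff[OF assms(1), of G F] by (auto split: if_splits)
    show ?thesis
    proof (cases "e \<in> D")
      case True
      have "insert j (D - {e}) \<subseteq> insert j (G - {e})" using G by auto
      moreover have "j \<notin> D" using G G' by auto
      ultimately have "insert j (D - {e}) \<in> shadow r F"
        using swap[of j e] True G' by (auto simp: shadow_def)
      then show ?thesis using True \<open>j \<notin> D\<close> by (auto simp: shift_iff[OF assms(1)])
    next
      case False
      then have "D \<subseteq> insert j (G - {e})" using G by auto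
      then have "D \<in> shadow r F" using G G' by (auto simp: shadow_def)
      then show ?thesis using False G G' by (auto simp: shift_iff[OF assms(1)])
    qed
  qed
qed

lemma finite_shadow:
  assumes "finite X" "\<And>A. A \<in> F \<Longrightarrow> A \<subseteq> X"
  shows "finite (shadow r F)"
proof (rule finite_subset)
  show "shadow r F \<subseteq> Pow X" using assms(2) by (auto simp: shadow_def)
qed (use assms in simp)

text \<open>Among the families of the same size with no larger shadow, one with the most members
  containing \<open>e\<close> is stable: a failing exchange would let a shift increase that
  number.\<close>

lemma exists_shifted:
  assumes "finite X" "e \<in> X" "F \<subseteq> {A. A \<subseteq> X \<and> card A = t}"
  obtains G where "G \<subseteq> {A. A \<subseteq> X \<and> card A = t}" "card G = card F"
    "card (shadow r G) \<le> card (shadow r F)"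
    "\<And>A x. A \<in> G \<Longrightarrow> e \<notin> A \<Longrightarrow> x \<in> A \<Longrightarrow> insert e (A - {x}) \<in> G"
proof -
  define U where "U = {A. A \<subseteq> X \<and> card A = t}"
  define P where "P G \<longleftrightarrow> G \<subseteq> U \<and> card G = card F \<and> card (shadow r G) \<le> card (shadow r F)" for G
  define w where "w G = card {A \<in> G. e \<in> A}" for G :: "'a set set"
  have finU: "finite U" using assms(1) by (simp add: U_def)
  have "P F" using assms by (simp add: P_def U_def)
  moreover have "w G < Suc (card U)" if "P G" for G
    unfolding w_def less_Suc_eq_le using that finU by (intro card_mono) (auto simp: P_def)
  ultimately have "\<exists>G. P G \<and> (\<forall>H. P H \<longrightarrow> w H \<le> w G)"
    using Lattices_Big.ex_has_greatest_nat[of P F w "Suc (card U)"] by simp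
  then obtain G where G: "P G" "\<And>H. P H \<Longrightarrow> w H \<le> w G" by blast
  have finG: "finite G" using G(1) finU finite_subset by (auto simp: P_def)
  have GU: "G \<subseteq> U" using G(1) by (simp add: P_def)
  have fin: "finite A" if "A \<in> G" for A
  proof (rule finite_subset[OF _ assms(1)])
    show "A \<subseteq> X" using that GU by (auto simp: U_def)
  qed
  have "insert e (A - {x}) \<in> G" if A: "A \<in> G" "e \<notin> A" "x \<in> A" for A x
  proof (rule ccontr)
    assume neg: "insert e (A - {x}) \<notin> G"
    have ex: "e \<noteq> x" using A by auto
    let ?H = "shift e x G"
    have "?H \<subseteq> U"
    proof
      fix B assume "B \<in> ?H"
      then obtain C where C: "C \<in> G" "B = shift_map e x G C" by (auto simp: shift_def)
      have "C \<subseteq> X" "card C = t" "finite C" using C(1) GU fin by (auto simp: U_def)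
      then show "B \<in> U" using C(2) assms(2) card_swap[of C e x]
        by (auto simp: U_def shift_map_def)
    qed
    moreover have "card (shadow r ?H) \<le> card (shadow r G)"
    proof -
      have "finite (shadow r G)" by (rule finite_shadow[OF assms(1)]) (use GU in \<open>auto simp: U_def\<close>)
      then have "finite (shift e x (shadow r G))" by (simp add: shift_def)
      from card_mono[OF this shadow_shift[OF ex fin]] show ?thesis by (simp add: card_shift)
    qed
    ultimately have "P ?H" using G(1) by (auto simp: P_def card_shift)
    then have le: "w ?H \<le> w G" by (rule G(2))
    have "insert x (insert e (A - {x}) - {e}) = A" using A by auto
    then have "insert e (A - {x}) \<in> ?H" using A ex by (simp add: shift_iff[OF ex])
    moreover have "B \<in> ?H" if "B \<in> G" "e \<in> B" for B
      using that by (simp add: shift_iff[OF ex])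
    ultimately have "{B \<in> G. e \<in> B} \<subset> {B \<in> ?H. e \<in> B}"
      using neg by blast
    moreover have "finite ?H" using finG by (simp add: shift_def)
    ultimately have "w G < w ?H" unfolding w_def by (intro psubset_card_mono) auto
    then show False using le by simp
  qed
  then show thesis using that G(1) by (auto simp: P_def U_def)
qed

text \<open>Induction on the ground set, after shifting towards an element \<open>e\<close>. With
  \<open>G1\<close> the sets through \<open>e\<close>, stripped of \<open>e\<close>, the shadow
  contains \<open>shadow r G1\<close> and, for \<open>r > 0\<close>, the members of
  \<open>shadow (r - 1) G1\<close> with \<open>e\<close> added; Pascal's rule adds up the two
  bounds.\<close>

theorem kruskal_katona:
  fixes X :: "'a set"
  assumes "finite X" "F \<subseteq> {A. A \<subseteq> X \<and> card A = t}" "r < t"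
    "cascade_below t M cs" "cascade_sum t cs \<le> card F"
  shows "cascade_sum r cs \<le> card (shadow r F)"
  using assms
proof (induction X arbitrary: F t r M cs rule: finite_induct)
  case empty
  then have "F = {}" by auto
  then have "cascade_sum t cs = 0" using empty by simp
  then have "cs = []" using empty by (cases cs; cases t) auto
  then show ?case by simp
next
  case (insert e X)
  obtain G where G: "G \<subseteq> {A. A \<subseteq> insert e X \<and> card A = t}" "card G = card F"
    "card (shadow r G) \<le> card (shadow r F)"
    and stable: "\<And>A x. A \<in> G \<Longrightarrow> e \<notin> A \<Longrightarrow> x \<in> A \<Longrightarrow> insert e (A - {x}) \<in> G"
    using exists_shifted[of "insert e X" e F t r] insert by blast
  obtain u where u: "t = Suc u" using insert by (cases t) auto
  define G1 where "G1 = {B. B \<subseteq> X \<and> insert e B \<in> G}"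
  define G0 where "G0 = {B \<in> G. e \<notin> B}"
  let ?cs = "map (\<lambda>c. c - 1) cs"
  have finX: "finite (insert e X)" using insert by simp
  have finG: "finite G" by (rule finite_subset[OF G(1)]) (simp add: insert)
  have finB: "finite B" if "B \<subseteq> X" for B using finite_subset[OF that insert.hyps(1)] .
  have G1: "G1 \<subseteq> {A. A \<subseteq> X \<and> card A = u}"
  proof
    fix B assume B: "B \<in> G1"
    then have "card (insert e B) = t" "B \<subseteq> X" using G(1) by (auto simp: G1_def)
    moreover then have "e \<notin> B" "finite B" using insert finB by auto
    ultimately show "B \<in> {A. A \<subseteq> X \<and> card A = u}" by (simp add: u)
  qed
  have G0: "G0 \<subseteq> {A. A \<subseteq> X \<and> card A = t}" using G(1) by (auto simp: G0_def)
  have fin1: "finite G1" by (rule finite_subset[OF G1]) (simp add: insert)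
  have fin0: "finite G0" by (rule finite_subset[OF G0]) (simp add: insert)
  have Gsplit: "G = G0 \<union> insert e ` G1"
  proof (intro equalityI subsetI)
    fix A assume A: "A \<in> G"
    show "A \<in> G0 \<union> insert e ` G1"
    proof (cases "e \<in> A")
      case True
      then have "insert e (A - {e}) = A" by auto
      moreover have "A - {e} \<subseteq> X" using A G(1) by auto
      ultimately show ?thesis using A by (auto simp: G1_def intro!: image_eqI[of _ _ "A - {e}"])
    qed (use A in \<open>simp add: G0_def\<close>)
  qed (auto simp: G0_def G1_def)
  have inj: "inj_on (insert e) G1"
    by (rule inj_on_insert_of_notin) (use G1 insert.hyps(2) in auto)
  have "card (G0 \<union> insert e ` G1) = card G0 + card (insert e ` G1)"
    using fin0 fin1 by (intro card_Un_disjoint) (auto simp: G0_def)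
  then have cardG: "card G = card G0 + card G1"
    using Gsplit card_image[OF inj] by simp
  have pos: "\<forall>c\<in>set cs. 1 \<le> c" using cascade_below_pos[OF insert.prems(3)] by auto
  have split: "cascade_sum t cs = cascade_sum t ?cs + cascade_sum u ?cs"
    using cascade_sum_Suc_pred[OF pos, of u] u by simp
  \<comment> \<open>If \<open>G1\<close> were smaller, \<open>G0\<close> would exceed the lowered
    \<open>t\<close>-sum by at least 1, which pays for \<open>cascade_repair\<close>. The induction
    hypothesis would then make the shadow of \<open>G0\<close> larger than \<open>G1\<close>, which
    contains it.\<close>
  have claim: "cascade_sum u ?cs \<le> card G1"
  proof (rule ccontr)
    assume neg: "\<not> cascade_sum u ?cs \<le> card G1"
    have big: "cascade_sum t ?cs + 1 \<le> card G0"
      using neg cardG split insert.prems(4) G(2) by linarith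
    \<comment> \<open>The bound on the entries is raised so that it exceeds \<open>t\<close>, as
      \<open>cascade_repair\<close> demands.\<close>
    have "cascade_below t (Suc (M + t + 1)) cs"
      using cascade_below_mono[OF insert.prems(3)] by simp
    from cascade_repair[OF this] obtain ds where ds: "cascade_below t (M + t + 1) ds"
      "cascade_sum t ds \<le> cascade_sum t ?cs + 1" "cascade_sum u ?cs \<le> cascade_sum u ds"
      by (auto simp: u)
    have "cascade_sum u ds \<le> card (shadow u G0)"
      by (rule insert.IH[OF G0 _ ds(1)]) (use ds big u in auto)
    \<comment> \<open>By stability, a member of \<open>G0\<close> with one element replaced by
      \<open>e\<close> is in \<open>G\<close>; so with that element deleted it is in
      \<open>G1\<close>.\<close>
    also have "\<dots> \<le> card G1"
    proof (rule card_mono[OF fin1], rule subsetI)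
      fix D assume "D \<in> shadow u G0"
      then obtain A where A: "card D = u" "A \<in> G" "e \<notin> A" "D \<subseteq> A"
        by (auto simp: shadow_def G0_def)
      have AX: "A \<subseteq> X" "card A = t" using A G(1) by auto
      have "finite A" by (rule finB[OF AX(1)])
      then have "card (A - D) = 1" using A AX(2) u finite_subset[of D A] by (simp add: card_Diff_subset)
      then obtain x where x: "A - D = {x}" by (auto simp: card_1_singleton_iff)
      then have "x \<in> A" "D = A - {x}" using A by auto
      then show "D \<in> G1" using stable[OF A(2,3)] AX by (auto simp: G1_def)
    qed
    finally show False using ds neg by simp
  qed
  have sub: "cascade_sum q ?cs \<le> card (shadow q G1)" if "q \<le> u" for q
  proof (cases "q = u")
    case True
    have "G1 \<subseteq> shadow q G1" using G1 True by (auto simp: shadow_def)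
    then have "card G1 \<le> card (shadow q G1)"
      by (rule card_mono[rotated]) (rule finite_shadow[OF insert.hyps(1)], use G1 in auto)
    then show ?thesis using claim True by simp
  next
    case False
    then have q: "q < u" using that by simp
    \<comment> \<open>Cutting to \<open>t - 1\<close> entries makes the lowered list a
      \<open>u\<close>-cascade, and its \<open>q\<close>-sum is unchanged because
      \<open>q < u\<close>.\<close>
    let ?ds = "map (\<lambda>c. c - 1) (take (t - 1) cs)"
    have ds: "?ds = take u ?cs" by (simp add: u take_map)
    have "cascade_sum q ?ds \<le> card (shadow q G1)"
    proof (rule insert.IH[OF G1 q])
      show "cascade_below u (M - 1) ?ds" using cascade_below_map_pred[OF insert.prems(3)] u by simp
      show "cascade_sum u ?ds \<le> card G1" unfolding ds
        using cascade_sum_take_le claim by (rule order_trans)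
    qed
    then show ?thesis unfolding ds using cascade_sum_take[OF q] by simp
  qed
  have finS: "finite (shadow r G)" by (rule finite_shadow[OF finX]) (use G in auto)
  have "cascade_sum r cs \<le> card (shadow r G)"
  proof (cases r)
    case 0
    show ?thesis
    proof (cases "cs = []")
      case False
      then have "cascade_sum t cs \<noteq> 0" using insert.prems(3) by (cases cs; cases t) auto
      then have "G \<noteq> {}" using insert.prems(4) G(2) by auto
      then have "{} \<in> shadow r G" using 0 by (auto simp: shadow_def)
      then have "1 \<le> card (shadow r G)" using finS card_gt_0_iff[of "shadow r G"] by auto
      then show ?thesis using 0 by (simp add: cascade_sum_0)
    qed simp
  next
    case (Suc q)
    have f: "finite (shadow p G1)" for p by (rule finite_shadow[OF insert.hyps(1)]) (use G1 in auto)
    have DX: "D \<subseteq> X" if "D \<in> shadow p G1" for D p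
      using that G1 unfolding shadow_def by blast
    have noe: "e \<notin> D" "finite D" if "D \<in> shadow p G1" for D p
      using DX[OF that] insert.hyps(2) finB by auto
    have injq: "inj_on (insert e) (shadow q G1)"
      by (rule inj_on_insert_of_notin) (rule noe(1))
    have "shadow r G1 \<inter> insert e ` shadow q G1 = {}" using noe(1)[of _ r] by blast
    then have "card (shadow r G1 \<union> insert e ` shadow q G1)
      = card (shadow r G1) + card (insert e ` shadow q G1)"
      by (intro card_Un_disjoint f finite_imageI)
    then have "card (shadow r G1 \<union> insert e ` shadow q G1)
      = card (shadow r G1) + card (shadow q G1)"
      unfolding card_image[OF injq] .
    moreover have "shadow r G1 \<union> insert e ` shadow q G1 \<subseteq> shadow r G"
    proof (rule Un_least)
      show "shadow r G1 \<subseteq> shadow r G" unfolding shadow_def G1_def by blast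
      show "insert e ` shadow q G1 \<subseteq> shadow r G"
      proof
        fix D assume "D \<in> insert e ` shadow q G1"
        then obtain E where E: "E \<in> shadow q G1" "D = insert e E" by auto
        then obtain B where B: "E \<subseteq> B" "insert e B \<in> G" "card E = q"
          by (auto simp: shadow_def G1_def)
        have "card D = r" using noe[OF E(1)] E(2) B(3) Suc by simp
        moreover have "D \<subseteq> insert e B" using B(1) E(2) by auto
        ultimately show "D \<in> shadow r G" using B(2) unfolding shadow_def by blast
      qed
    qed
    ultimately have "card (shadow r G1) + card (shadow q G1) \<le> card (shadow r G)"
      using card_mono[OF finS] by metis
    moreover have "cascade_sum r ?cs \<le> card (shadow r G1)"
      using insert.prems(2) u by (intro sub) simp
    moreover have "cascade_sum q ?cs \<le> card (shadow q G1)"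
      using insert.prems(2) u Suc by (intro sub) simp
    ultimately show ?thesis using cascade_sum_Suc_pred[OF pos, of q] Suc by simp
  qed
  then show ?case using G(3) by simp
qed

section \<open>Cross-intersecting families\<close>

text \<open>The largest number of \<open>a\<close>-subsets of an \<open>M\<close>-set that meet each of the first \<open>g\<close> of its
  \<open>d\<close>-subsets in lexicographic order (for \<open>a + d \<le> M\<close>). If \<open>g\<close> is smaller than the number of
  \<open>d\<close>-sets through the first element, that element is removed from all of them;
  otherwise every one of the \<open>a\<close>-sets has to contain it.\<close>

fun max_cross :: "nat \<Rightarrow> nat \<Rightarrow> nat \<Rightarrow> nat \<Rightarrow> nat" where
  "max_cross 0 a d g = (if g = 0 then 0 choose a else 0)"
| "max_cross (Suc M) a d g =
     (if g = 0 then Suc M choose a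
      else if a = 0 \<or> d = 0 then 0
      else if g < M choose (d - 1) then (M choose (a - 1)) + max_cross M a (d - 1) g
      else max_cross M (a - 1) d (g - (M choose (d - 1))))"

lemma max_cross_0 [simp]: "max_cross M a d 0 = M choose a"
  by (cases M) auto

lemma max_cross_a0: "0 < g \<Longrightarrow> max_cross M 0 d g = 0"
  by (cases M) auto

lemma max_cross_d0: "0 < g \<Longrightarrow> max_cross M a 0 g = 0"
  by (cases M) auto

lemma max_cross_right:
  "d \<le> M \<Longrightarrow> max_cross (Suc M) (Suc a) (Suc d) ((M choose d) + g) = max_cross M a (Suc d) g"
  by auto

text \<open>Behind the value 0: when \<open>a + d \<le> M\<close>, every \<open>a\<close>-set is
  disjoint from some \<open>d\<close>-set.\<close>

lemma max_cross_full: "a + d \<le> M \<Longrightarrow> max_cross M a d (M choose d) = 0"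
proof (induction M arbitrary: a d)
  case (Suc M)
  show ?case
  proof (cases "a = 0 \<or> d = 0")
    case True
    then show ?thesis using Suc.prems
      by (auto simp del: max_cross.simps intro!: max_cross_a0 max_cross_d0)
  next
    case False
    then obtain a' d' where "a = Suc a'" "d = Suc d'" by (cases a; cases d) auto
    then show ?thesis using Suc max_cross_right[of d' M a' "M choose Suc d'"] by simp
  qed
qed auto

text \<open>At \<open>g = M choose d\<close> the definition takes its other branch, but the values
  agree since \<open>max_cross M (Suc a) d g\<close> vanishes there. Later case splits can thus use
  the closed range.\<close>

lemma max_cross_left:
  assumes "Suc a + d \<le> M" "g \<le> M choose d"
  shows "max_cross (Suc M) (Suc a) (Suc d) g = (M choose a) + max_cross M (Suc a) d g"
proof (cases "g = M choose d")
  case True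
  then show ?thesis
    using max_cross_right[of d M a 0] max_cross_full[OF assms(1)] assms by simp
next
  case False
  then show ?thesis using assms by simp
qed

declare max_cross.simps [simp del]

text \<open>For \<open>a \<le> t\<close>, an \<open>a\<close>-set misses a \<open>d\<close>-set
  exactly when it lies in the complement, a \<open>t\<close>-set, so \<open>cascade_sum a cs\<close>
  counts the excluded \<open>a\<close>-sets as a shadow. The proof follows the recursion: over
  \<open>Suc M\<close> elements, the second branch is taken exactly when the leading entry is
  \<open>M\<close>.\<close>

lemma max_cross_cascade:
  assumes "is_cascade t g cs" "hd cs < M" "t + d = M"
  shows "max_cross M a d g + cascade_sum a cs = M choose a"
  using assms
proof (induction M arbitrary: a d t g cs)
  case (Suc M)
  obtain c ds where cs: "cs = c # ds" using Suc.prems(1) by (cases cs) auto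
  have hd: "1 \<le> t" "t \<le> c" "c choose t \<le> g" "g < Suc c choose t"
    using is_cascade_hd_bounds[OF Suc.prems(1)] cs by auto
  have g: "0 < g" using hd zero_less_binomial[of t c] by linarith
  obtain e where d: "d = Suc e" using Suc.prems hd cs by (cases d) auto
  have te: "M choose t = M choose e" using binomial_symmetric[of e M] Suc.prems(3) d by auto
  show ?case
  proof (cases a)
    case 0
    then show ?thesis using g cs by (simp add: max_cross_a0)
  next
    case a: (Suc b)
    show ?thesis
    proof (cases "c = M")
      case False
      then have c: "Suc c \<le> M" using Suc.prems cs by simp
      then have "Suc c choose t \<le> M choose t" by (rule binomial_right_mono)
      then have "g < M choose e" using hd te by simp
      then have "max_cross (Suc M) a d g = (M choose b) + max_cross M a e g"
        using g a d by (simp add: max_cross.simps)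
      moreover have "max_cross M a e g + cascade_sum a cs = M choose a"
        using Suc.IH[OF Suc.prems(1)] c cs Suc.prems(3) d by simp
      ultimately show ?thesis using a by simp
    next
      case True
      have step: "max_cross (Suc M) a d ((M choose e) + h) = max_cross M b d h" for h
        using max_cross_right[of e M b h] Suc.prems d a by simp
      show ?thesis
      proof (cases ds)
        case Nil
        then have "g = M choose e" using Suc.prems(1) cs True te by (simp add: is_cascade_single)
        then show ?thesis using step[of 0] Nil cs a True by simp
      next
        case (Cons c' es)
        then obtain h where h: "is_cascade (t - 1) h ds" "g = (M choose e) + h" "c' < M"
          using Suc.prems(1) cs True te by (auto simp: is_cascade_Cons2)
        have "max_cross M b d h + cascade_sum b ds = M choose b"
          by (rule Suc.IH[OF h(1)]) (use Cons h Suc.prems(3) hd in auto)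
        then show ?thesis using step[of h] h a cs True by simp
      qed
    qed
  qed
qed simp

text \<open>The complements of the members of \<open>\<B>\<close> are \<open>(M - d)\<close>-sets.
  Every \<open>a\<close>-set in their shadow misses a member of \<open>\<B>\<close>, so the shadow
  is disjoint from \<open>\<A>\<close>, and Kruskal-Katona bounds it from below.\<close>

theorem cross_intersecting_card_le:
  fixes X :: "'a set"
  assumes "finite X" "card X = M" "a + d < M"
    "\<A> \<subseteq> {A. A \<subseteq> X \<and> card A = a}" "\<B> \<subseteq> {B. B \<subseteq> X \<and> card B = d}"
    "\<And>A B. A \<in> \<A> \<Longrightarrow> B \<in> \<B> \<Longrightarrow> A \<inter> B \<noteq> {}"
    "card \<B> < M choose d"
  shows "card \<A> \<le> max_cross M a d (card \<B>)"
proof (cases "\<B> = {}")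
  case True
  have "card \<A> \<le> card {A. A \<subseteq> X \<and> card A = a}"
    by (rule card_mono) (use assms in auto)
  then show ?thesis using True assms by (simp add: n_subsets)
next
  case False
  define t where "t = M - d"
  define \<C> where "\<C> = (\<lambda>B. X - B) ` \<B>"
  have finB: "finite \<B>" by (rule finite_subset[OF assms(5)]) (use assms in auto)
  have inj: "inj_on (\<lambda>B. X - B) \<B>" using assms(5) by (intro inj_onI) blast
  then have cardC: "card \<C> = card \<B>" unfolding \<C>_def by (rule card_image)
  have C: "\<C> \<subseteq> {A. A \<subseteq> X \<and> card A = t}"
  proof
    fix A assume "A \<in> \<C>"
    then obtain B where "B \<in> \<B>" "A = X - B" by (auto simp: \<C>_def)
    then show "A \<in> {A. A \<subseteq> X \<and> card A = t}"
      using assms by (auto simp: t_def card_Diff_subset finite_subset)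
  qed
  have pos: "1 \<le> card \<B>" using False finB by (simp add: Suc_le_eq card_gt_0_iff)
  obtain cs where cs: "is_cascade t (card \<B>) cs"
    using is_cascade_exists[OF _ pos, of t] assms(3) by (fastforce simp: t_def)
  \<comment> \<open>Strictness of the bound on \<open>card \<B>\<close> matters here: at equality
    the leading entry would be \<open>M\<close> itself.\<close>
  have hd: "hd cs < M"
    by (rule is_cascade_hd_less[OF cs])
      (use assms(3,7) binomial_symmetric[of d M] in \<open>simp add: t_def\<close>)
  have "cascade_sum a cs \<le> card (shadow a \<C>)"
    by (rule kruskal_katona[OF assms(1) C])
      (use is_cascade_cascade_below[OF cs hd] cardC assms in \<open>auto simp: t_def\<close>)
  moreover have finS: "finite (shadow a \<C>)" by (rule finite_shadow[OF assms(1)]) (use C in auto)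
  moreover have finA: "finite \<A>" by (rule finite_subset[OF assms(4)]) (use assms in auto)
  moreover have "\<A> \<inter> shadow a \<C> = {}"
  proof (rule ccontr)
    assume "\<A> \<inter> shadow a \<C> \<noteq> {}"
    then obtain A B where "A \<in> \<A>" "B \<in> \<B>" "A \<subseteq> X - B" by (auto simp: shadow_def \<C>_def)
    then show False using assms(6)[of A B] by blast
  qed
  moreover have "card (\<A> \<union> shadow a \<C>) \<le> M choose a"
  proof -
    have "\<A> \<union> shadow a \<C> \<subseteq> {A. A \<subseteq> X \<and> card A = a}"
      using assms(4) C unfolding shadow_def by blast
    from card_mono[OF _ this] show ?thesis using assms by (simp add: n_subsets)
  qed
  ultimately have "card \<A> + cascade_sum a cs \<le> M choose a"
    by (simp add: card_Un_disjoint)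
  then show ?thesis using max_cross_cascade[OF cs hd, of d a] assms(3) by (simp add: t_def)
qed

lemma card_insert_image:
  assumes "\<And>B. B \<in> \<B> \<Longrightarrow> e \<notin> B"
  shows "card (insert e ` \<B>) = card \<B>"
  by (rule card_image, rule inj_on_insert_of_notin) (rule assms)

text \<open>The construction follows \<open>max_cross\<close> with a chosen element
  \<open>e\<close>: either \<open>e\<close> joins every \<open>d\<close>-set and all
  \<open>a\<close>-sets through \<open>e\<close> are taken, or the roles of the two families are
  exchanged.\<close>

theorem cross_intersecting_exists:
  fixes X :: "'a set"
  assumes "finite X" "card X = M" "a + d \<le> M" "g \<le> M choose d"
  shows "\<exists>\<A> \<B>. \<A> \<subseteq> {A. A \<subseteq> X \<and> card A = a} \<and> \<B> \<subseteq> {B. B \<subseteq> X \<and> card B = d} \<and>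
    (\<forall>A\<in>\<A>. \<forall>B\<in>\<B>. A \<inter> B \<noteq> {}) \<and> card \<A> = max_cross M a d g \<and> card \<B> = g"
  using assms
proof (induction M arbitrary: X a d g)
  case 0
  then have "a = 0" "d = 0" by auto
  show ?case
  proof (cases "g = 0")
    case True
    then show ?thesis using 0 by (intro exI[of _ "{{}}"] exI[of _ "{}"]) auto
  next
    case False
    then have "g = 1" using 0 by (cases d) auto
    then show ?thesis using 0
      by (intro exI[of _ "{}"] exI[of _ "{{}}"]) (auto simp: max_cross_a0)
  qed
next
  case (Suc M)
  let ?P = "\<lambda>X k. {A. A \<subseteq> X \<and> card A = k}"
  have fin: "finite (?P X k)" for k using Suc.prems(1) by simp
  consider "g = 0" | "0 < g" "a = 0 \<or> d = 0" | a' d' where "0 < g" "a = Suc a'" "d = Suc d'"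
    by (cases g; cases a; cases d) auto
  then show ?case
  proof cases
    case 1
    then show ?thesis using Suc.prems
      by (intro exI[of _ "?P X a"] exI[of _ "{}"]) (auto simp: n_subsets)
  next
    case 2
    then have "max_cross (Suc M) a d g = 0" by (auto simp: max_cross_a0 max_cross_d0)
    moreover obtain \<B> where "\<B> \<subseteq> ?P X d" "card \<B> = g"
      using obtain_subset_with_card_n[of g "?P X d"] Suc.prems by (auto simp: n_subsets)
    ultimately show ?thesis by (intro exI[of _ "{}"] exI[of _ \<B>]) auto
  next
    case 3
    obtain e where e: "e \<in> X" using Suc.prems by fastforce
    let ?X = "X - {e}"
    have X: "finite ?X" "card ?X = M" using Suc.prems e by auto
    have finX: "finite A" if "A \<subseteq> ?X" for A using that X finite_subset by blast
    have ins: "insert e A \<subseteq> X \<and> card (insert e A) = Suc k" if "A \<in> ?P ?X k" for A k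
    proof -
      have "e \<notin> A" "finite A" using that finX[of A] by auto
      then show ?thesis using that e by auto
    qed
    have finP: "finite (?P ?X k)" for k using X(1) by simp
    show ?thesis
    proof (cases "g \<le> M choose d'")
      case True
      obtain \<A> \<B> where AB: "\<A> \<subseteq> ?P ?X a" "\<B> \<subseteq> ?P ?X d'"
        "\<forall>A\<in>\<A>. \<forall>B\<in>\<B>. A \<inter> B \<noteq> {}" "card \<A> = max_cross M a d' g" "card \<B> = g"
        using Suc.IH[OF X, of a d' g] True Suc.prems 3 by auto
      let ?A = "insert e ` ?P ?X a' \<union> \<A>" and ?B = "insert e ` \<B>"
      have "card ?A = card (insert e ` ?P ?X a') + card \<A>"
        using finP finite_subset[OF AB(1) finP] AB(1) by (intro card_Un_disjoint) auto
      also have "card (insert e ` ?P ?X a') = M choose a'"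
        using X by (subst card_insert_image) (auto simp: n_subsets)
      finally have "card ?A = max_cross (Suc M) a d g"
        using AB(4) 3 True Suc.prems by (simp add: max_cross_left)
      have "card ?B = g" using AB by (subst card_insert_image) auto
      have "?A \<subseteq> ?P X a"
      proof (rule Un_least)
        show "insert e ` ?P ?X a' \<subseteq> ?P X a" using ins[of _ a'] 3 by blast
      qed (use AB(1) in blast)
      have "?B \<subseteq> ?P X d"
      proof (rule image_subsetI)
        fix B assume "B \<in> \<B>"
        then have "B \<in> ?P ?X d'" using AB(2) by (rule set_mp[rotated])
        from ins[OF this] show "insert e B \<in> ?P X d" using 3 by simp
      qed
      have "A \<inter> B \<noteq> {}" if "A \<in> ?A" "B \<in> ?B" for A B
      proof -
        obtain B' where B': "B' \<in> \<B>" "B = insert e B'" using \<open>B \<in> ?B\<close> by blast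
        show ?thesis
        proof (cases "A \<in> \<A>")
          case True
          then have "A \<inter> B' \<noteq> {}" using AB(3) B'(1) by blast
          then show ?thesis using B'(2) by blast
        next
          case False
          then show ?thesis using \<open>A \<in> ?A\<close> B'(2) by blast
        qed
      qed
      show ?thesis by (intro exI[of _ ?A] exI[of _ ?B] conjI ballI) fact+
    next
      case False
      then obtain h where h: "g = (M choose d') + h" by (metis le_Suc_ex nat_le_linear not_less)
      have d': "d' \<le> M" using Suc.prems 3 by simp
      obtain \<A> \<B> where AB: "\<A> \<subseteq> ?P ?X a'" "\<B> \<subseteq> ?P ?X d"
        "\<forall>A\<in>\<A>. \<forall>B\<in>\<B>. A \<inter> B \<noteq> {}" "card \<A> = max_cross M a' d h" "card \<B> = h"
        using Suc.IH[OF X, of a' d h] Suc.prems 3 h by auto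
      let ?A = "insert e ` \<A>" and ?B = "insert e ` ?P ?X d' \<union> \<B>"
      have "card ?B = card (insert e ` ?P ?X d') + card \<B>"
        using finP finite_subset[OF AB(2) finP] AB(2) by (intro card_Un_disjoint) auto
      also have "card (insert e ` ?P ?X d') = M choose d'"
        using X by (subst card_insert_image) (auto simp: n_subsets)
      finally have "card ?B = g" using AB(5) h by simp
      have "card ?A = max_cross (Suc M) a d g"
        using AB(1,4) 3 h d' by (subst card_insert_image) (auto simp: max_cross_right)
      have "?B \<subseteq> ?P X d"
      proof (rule Un_least)
        show "insert e ` ?P ?X d' \<subseteq> ?P X d" using ins[of _ d'] 3 by blast
      qed (use AB(2) in blast)
      have "?A \<subseteq> ?P X a"
      proof (rule image_subsetI)
        fix A assume "A \<in> \<A>"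
        then have "A \<in> ?P ?X a'" using AB(1) by (rule set_mp[rotated])
        from ins[OF this] show "insert e A \<in> ?P X a" using 3 by simp
      qed
      have "A \<inter> B \<noteq> {}" if "A \<in> ?A" "B \<in> ?B" for A B
      proof -
        obtain A' where A': "A' \<in> \<A>" "A = insert e A'" using \<open>A \<in> ?A\<close> by blast
        show ?thesis
        proof (cases "B \<in> \<B>")
          case True
          then have "A' \<inter> B \<noteq> {}" using AB(3) A'(1) by blast
          then show ?thesis using A'(2) by blast
        next
          case False
          then show ?thesis using \<open>B \<in> ?B\<close> A'(2) by blast
        qed
      qed
      show ?thesis by (intro exI[of _ ?A] exI[of _ ?B] conjI ballI) fact+
    qed
  qed
qed

section \<open>The total size of a lexicographic pair\<close>

text \<open>Each branch adds one binomial coefficient to the bound of the induction, and Pascal's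
  rule restores the shape. For \<open>a = d\<close> the bound is the total attained by all
  \<open>d\<close>-sets alone.\<close>

lemma max_cross_add_le:
  "a + d \<le> M \<Longrightarrow> g \<le> M choose d \<Longrightarrow>
     g + max_cross M a d g \<le> max (M choose a) (M choose d)"
proof (induction M arbitrary: a d g)
  case 0
  then show ?case by (cases "g = 0") (auto simp: max_cross_a0)
next
  case (Suc M)
  consider "g = 0" | "0 < g" "a = 0 \<or> d = 0" | a' d' where "0 < g" "a = Suc a'" "d = Suc d'"
    by (cases g; cases a; cases d) auto
  then show ?case
  proof cases
    case 1
    then show ?thesis by simp
  next
    case 2
    then show ?thesis using Suc.prems by (auto simp: max_cross_a0 max_cross_d0)
  next
    case 3
    show ?thesis
    proof (cases "g \<le> M choose d'")
      case True
      have IH: "g + max_cross M a d' g \<le> max (M choose a) (M choose d')"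
        using Suc.IH[of a d' g] True Suc.prems 3 by simp
      \<comment> \<open>This handles the mixed sum \<open>(M choose a') + (M choose d')\<close>: it
        is at most one of the two sums that Pascal's rule yields.\<close>
      have "M choose a' \<le> M choose d \<or> M choose d' \<le> M choose a"
      proof (cases "a' \<le> d")
        case True
        then show ?thesis using binomial_le_of_sum_le[of a' d M] Suc.prems 3 by simp
      next
        case False
        then show ?thesis using binomial_le_of_sum_le[of d' a M] Suc.prems 3 by simp
      qed
      then show ?thesis using IH 3 True Suc.prems by (auto simp: max_cross_left)
    next
      case False
      then obtain h where h: "g = (M choose d') + h" by (metis le_Suc_ex nat_le_linear not_less)
      have IH: "h + max_cross M a' d h \<le> max (M choose a') (M choose d)"
        using Suc.IH[of a' d h] Suc.prems 3 h by simp
      have "M choose a' \<le> M choose d \<or> M choose d' \<le> M choose a"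
      proof (cases "a' \<le> d")
        case True
        then show ?thesis using binomial_le_of_sum_le[of a' d M] Suc.prems 3 by simp
      next
        case False
        then show ?thesis using binomial_le_of_sum_le[of d' a M] Suc.prems 3 by simp
      qed
      then show ?thesis using IH 3 h Suc.prems by (auto simp: max_cross_right)
    qed
  qed
qed

text \<open>The recursion of \<open>max_cross\<close> never makes a step of the second kind to a state with
  \<open>a \<le> d\<close>. In the paper's notation the second kind of step is made at the elements of
  \<open>T\<^sub>\<gamma>\<close>, and reaching \<open>b\<^sub>i\<close> there are \<open>b\<^sub>i - 1 - 2 * i\<close> more elements to choose for the \<open>a\<close>-sets
  than for the \<open>d\<close>-sets; tameness asks this number
  to be at least \<open>2\<close>, that is \<open>b\<^sub>i > 2 * i + 2\<close>.\<close>

fun tame :: "nat \<Rightarrow> nat \<Rightarrow> nat \<Rightarrow> nat \<Rightarrow> bool" where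
  "tame 0 a d g \<longleftrightarrow> g = 0"
| "tame (Suc M) a d g \<longleftrightarrow> g = 0 \<or> d \<noteq> 0 \<and>
     (if g < M choose (d - 1) then tame M a (d - 1) g
      else d + 2 \<le> a \<and> tame M (a - 1) d (g - (M choose (d - 1))))"

lemma tame_0 [simp]: "tame M a d 0"
  by (cases M) auto

lemma tame_left: "g < M choose d \<Longrightarrow> tame (Suc M) a (Suc d) g \<longleftrightarrow> tame M a d g"
  by auto

lemma tame_right:
  "d \<le> M \<Longrightarrow> tame (Suc M) a (Suc d) ((M choose d) + g) \<longleftrightarrow>
     d + 3 \<le> a \<and> tame M (a - 1) (Suc d) g"
  by auto

declare tame.simps [simp del]

text \<open>The recursion is followed to the step at which tameness fails; it leads to a state with
  equal set sizes. The number \<open>g'\<close> is the end of the block in which this step is made,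
  and every number from \<open>g\<close> up to it fails at the same step.\<close>

lemma exists_larger_of_not_tame:
  assumes "d < a" "a + d \<le> M" "g < M choose d" "\<not> tame M a d g"
  shows "\<exists>g'. g < g' \<and> g' \<le> M choose d \<and> (\<forall>x. g \<le> x \<longrightarrow> x < g' \<longrightarrow> \<not> tame M a d x) \<and>
    g + max_cross M a d g \<le> g' + max_cross M a d g'"
  using assms
proof (induction M arbitrary: a d g)
  case (Suc M)
  have "g \<noteq> 0" using Suc.prems by (cases "g = 0") auto
  then have "d \<noteq> 0" using Suc.prems by (cases "d = 0") auto
  then obtain a' d' where ad: "a = Suc a'" "d = Suc d'" using Suc.prems by (cases a; cases d) auto
  show ?case
  proof (cases "g < M choose d'")
    case True
    then have "\<not> tame M a d' g" using Suc.prems ad by (simp add: tame_left)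
    then obtain g' where g': "g < g'" "g' \<le> M choose d'"
      "\<forall>x. g \<le> x \<longrightarrow> x < g' \<longrightarrow> \<not> tame M a d' x"
      "g + max_cross M a d' g \<le> g' + max_cross M a d' g'"
      using Suc.IH[of d' a g] True Suc.prems ad by auto
    have "\<not> tame (Suc M) a d x" if "g \<le> x" "x < g'" for x
    proof -
      have "\<not> tame M a d' x" using g'(3) that by blast
      moreover have "x < M choose d'" using that g'(2) by simp
      ultimately show ?thesis using ad by (simp add: tame_left)
    qed
    moreover have "g' \<le> Suc M choose d" using g'(2) ad by simp
    moreover have "g + max_cross (Suc M) a d g \<le> g' + max_cross (Suc M) a d g'"
      using g'(2,4) True ad Suc.prems(2) by (simp add: max_cross_left)
    ultimately show ?thesis using g'(1) by blast
  next
    case False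
    then obtain h where h: "g = (M choose d') + h" by (metis le_Suc_ex nat_le_linear not_less)
    have d': "d' \<le> M" using Suc.prems ad by simp
    show ?thesis
    proof (cases "d + 2 \<le> a")
      case True
      then have "\<not> tame M a' d h" using Suc.prems ad h d' by (simp add: tame_right)
      then obtain h' where h': "h < h'" "h' \<le> M choose d"
        "\<forall>x. h \<le> x \<longrightarrow> x < h' \<longrightarrow> \<not> tame M a' d x"
        "h + max_cross M a' d h \<le> h' + max_cross M a' d h'"
        using Suc.IH[of d a' h] True Suc.prems ad h by auto
      have "\<not> tame (Suc M) a d x" if "g \<le> x" "x < (M choose d') + h'" for x
      proof -
        have "M choose d' \<le> x" using that h by linarith
        then obtain y where y: "x = (M choose d') + y" using le_Suc_ex by blast
        then have "h \<le> y" "y < h'" using that h by simp_all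
        then have "\<not> tame M a' d y" using h'(3) by blast
        then show ?thesis using y d' ad by (simp add: tame_right)
      qed
      moreover have "g < (M choose d') + h'" "(M choose d') + h' \<le> Suc M choose d"
        using h h'(1,2) ad by simp_all
      moreover have "g + max_cross (Suc M) a d g
          \<le> (M choose d') + h' + max_cross (Suc M) a d ((M choose d') + h')"
        using h'(4) ad h d' by (simp add: max_cross_right)
      ultimately show ?thesis by blast
    next
      case False
      \<comment> \<open>With equal sizes the maximum in \<open>max_cross_add_le\<close> is
        \<open>M choose d\<close>, so the full number \<open>Suc M choose d\<close> has at least the
        total of \<open>g\<close>.\<close>
      then have a': "a' = d" using Suc.prems ad by simp
      have "h + max_cross M a' d h \<le> M choose d"
        using max_cross_add_le[of a' d M h] Suc.prems h ad a' by simp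
      then have "g + max_cross (Suc M) a d g \<le> Suc M choose d"
        using h ad d' by (simp add: max_cross_right)
      moreover have "\<not> tame (Suc M) a d x" if "g \<le> x" for x
      proof -
        have "M choose d' \<le> x" using that h by linarith
        then obtain y where y: "x = (M choose d') + y" using le_Suc_ex by blast
        then show ?thesis using False d' ad by (simp add: tame_right)
      qed
      moreover have "max_cross (Suc M) a d (Suc M choose d) = 0"
        by (rule max_cross_full[OF Suc.prems(2)])
      ultimately show ?thesis using Suc.prems(3) by (metis add_0_right order_refl)
    qed
  qed
qed simp

text \<open>Two numbers in the same branch are compared by induction. If the branch changes between
  them, the comparison passes through \<open>M choose d'\<close>, where the total is
  \<open>(M choose a') + (M choose d')\<close>; as this is the full number of the smaller state, the
  statement admits a full \<open>g'\<close>.\<close>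

lemma max_cross_add_strict_decreasing:
  assumes "d < a" "a + d < M" "tame M a d g" "g < g'" "g' \<le> M choose d"
    "tame M a d g' \<or> g' = M choose d"
  shows "g' + max_cross M a d g' < g + max_cross M a d g"
  using assms
proof (induction M arbitrary: a d g g')
  case (Suc M)
  show ?case
  proof (cases d)
    case 0
    then have g: "g = 0" "g' = 1" using Suc.prems by auto
    have "Suc M choose 0 < Suc M choose a"
      using binomial_less_of_sum_less[of 0 a "Suc M"] Suc.prems by simp
    then show ?thesis using g 0 by (simp add: max_cross_d0)
  next
    case d: (Suc d')
    then obtain a' where a: "a = Suc a'" using Suc.prems by (cases a) auto
    have d': "d' \<le> M" using Suc.prems d by simp
    show ?thesis
    proof (cases "g < M choose d'")
      case True
      have g: "max_cross (Suc M) a d g = (M choose a') + max_cross M a d' g"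
        using a d True Suc.prems by (simp add: max_cross_left)
      have tg: "tame M a d' g" using Suc.prems(3) True d by (simp add: tame_left)
      \<comment> \<open>The boundary is compared inside the smaller state, where it takes all
        \<open>d'\<close>-sets and \<open>max_cross\<close> is 0.\<close>
      have full: "(M choose d') < g + max_cross M a d' g"
        using Suc.IH[of d' a g "M choose d'"] Suc.prems True tg d by (simp add: max_cross_full)
      show ?thesis
      proof (cases "g' < M choose d'")
        case g': True
        then have neq: "g' \<noteq> Suc M choose d" using d by simp
        then have "tame M a d' g'" using Suc.prems(6) g' d by (simp add: tame_left)
        then have "g' + max_cross M a d' g' < g + max_cross M a d' g"
          using Suc.IH[of d' a g g'] Suc.prems tg g' d by simp
        then show ?thesis using g a d g' Suc.prems by (simp add: max_cross_left)
      next
        case False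
        then obtain h where h: "g' = (M choose d') + h" by (metis le_Suc_ex nat_le_linear not_less)
        \<comment> \<open>Beyond the boundary the total starts from \<open>M choose a'\<close> at
          \<open>h = 0\<close> and does not exceed it.\<close>
        have "h + max_cross M a' d h \<le> M choose a'"
        proof (cases "g' = Suc M choose d")
          case True
          then have "h = M choose d" using h d by simp
          moreover have "M choose d \<le> M choose a'"
            using binomial_le_of_sum_le[of d a' M] Suc.prems a by simp
          ultimately show ?thesis using max_cross_full[of a' d M] Suc.prems a by simp
        next
          case False
          then have t: "tame M a' d h" "d' + 3 \<le> a"
            using Suc.prems(6) h d d' a by (simp_all add: tame_right)
          show ?thesis
          proof (cases "h = 0")
            case False
            then show ?thesis
              using Suc.IH[of d a' 0 h] t a d Suc.prems h by simp
          qed simp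
        qed
        then show ?thesis using full g h a d d' by (simp add: max_cross_right)
      qed
    next
      case False
      then obtain h where h: "g = (M choose d') + h" by (metis le_Suc_ex nat_le_linear not_less)
      then obtain h' where h': "g' = (M choose d') + h'" "h < h'"
        using Suc.prems(4) nat_le_iff_add[of "M choose d'" g'] by auto
      have t: "tame M a' d h" "d' + 3 \<le> a"
        using Suc.prems(3) h d d' a by (simp_all add: tame_right)
      moreover have "tame M a' d h' \<or> h' = M choose d"
        using Suc.prems(6) h' d d' a by (auto simp: tame_right)
      ultimately have "h' + max_cross M a' d h' < h + max_cross M a' d h"
        using Suc.IH[of d a' h h'] a d Suc.prems h' by simp
      then show ?thesis using h h' a d d' by (simp add: max_cross_right)
    qed
  qed
qed simp

text \<open>The step that leaves \<open>c\<close> elements is of the second kind exactly when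
  \<open>c\<close> is an entry of the cascade. Before the step at \<open>cs ! i\<close> the sizes
  have fallen to \<open>a - i\<close> and \<open>d - (M - 1 - cs ! i - i)\<close>; a gap of at least
  2 between them is the stated inequality.\<close>

lemma tame_iff_cascade:
  assumes "is_cascade t g cs" "hd cs < M" "t + d = M"
  shows "tame M a d g \<longleftrightarrow> (\<forall>i<length cs. d + cs ! i + 3 + 2 * i \<le> a + M)"
  using assms
proof (induction M arbitrary: a d t g cs)
  case (Suc M)
  obtain c ds where cs: "cs = c # ds" using Suc.prems(1) by (cases cs) auto
  have hd: "1 \<le> t" "t \<le> c" "c choose t \<le> g" "g < Suc c choose t"
    using is_cascade_hd_bounds[OF Suc.prems(1)] cs by auto
  obtain e where d: "d = Suc e" using Suc.prems hd cs by (cases d) auto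
  have te: "M choose t = M choose e" using binomial_symmetric[of e M] Suc.prems(3) d by auto
  show ?case
  proof (cases "c = M")
    case False
    then have c: "Suc c \<le> M" using Suc.prems cs by simp
    then have "Suc c choose t \<le> M choose t" by (rule binomial_right_mono)
    then have "g < M choose e" using hd te by simp
    then have "tame (Suc M) a d g = tame M a e g" using d by (simp add: tame_left)
    also have "\<dots> \<longleftrightarrow> (\<forall>i<length cs. e + cs ! i + 3 + 2 * i \<le> a + M)"
      using Suc.IH[OF Suc.prems(1)] c cs Suc.prems(3) d by simp
    also have "\<dots> \<longleftrightarrow> (\<forall>i<length cs. d + cs ! i + 3 + 2 * i \<le> a + Suc M)"
      unfolding d add_Suc add_Suc_right Suc_le_mono ..
    finally show ?thesis .
  next
    case True
    have step: "tame (Suc M) a d ((M choose e) + h) \<longleftrightarrow> d + 2 \<le> a \<and> tame M (a - 1) d h" for h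
      using tame_right[of e M a h] Suc.prems(3) d by (simp add: numeral_eq_Suc)
    show ?thesis
    proof (cases ds)
      case Nil
      then have "g = M choose e" using Suc.prems(1) cs True te by (simp add: is_cascade_single)
      then show ?thesis using step[of 0] Nil cs True by auto
    next
      case (Cons c' es)
      then obtain h where h: "is_cascade (t - 1) h ds" "g = (M choose e) + h" "c' < M"
        using Suc.prems(1) cs True te by (auto simp: is_cascade_Cons2)
      have IH: "tame M (a - 1) d h \<longleftrightarrow> (\<forall>i<length ds. d + ds ! i + 3 + 2 * i \<le> a - 1 + M)"
        by (rule Suc.IH[OF h(1)]) (use Cons h Suc.prems(3) hd in auto)
      have "(\<forall>i<length cs. d + cs ! i + 3 + 2 * i \<le> a + Suc M) \<longleftrightarrow>
        d + 2 \<le> a \<and> (\<forall>i<length ds. d + ds ! i + 3 + 2 * Suc i \<le> a + Suc M)"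
        unfolding cs using True by (auto simp: All_less_Suc2)
      also have "\<dots> \<longleftrightarrow> d + 2 \<le> a \<and> (\<forall>i<length ds. d + ds ! i + 3 + 2 * i \<le> a - 1 + M)"
        by auto
      finally show ?thesis using IH h(2) step by simp
    qed
  qed
qed simp

section \<open>Cascade forms and resistant numbers\<close>

text \<open>Pascal's rule unwinds \<open>M choose a\<close> from the top. At a level outside the
  cascade the term with the smaller lower index goes into the sum; at an entry the other term goes
  into \<open>cascade_sum\<close>. At the last entry both terms are kept, which is why
  \<open>last cs\<close> is added back.\<close>

lemma cascade_sum_complement:
  assumes "sorted_wrt (>) cs" "cs \<noteq> []" "hd cs < M" "length cs \<le> a"
  shows "(\<Sum>y\<in>({last cs..<M} - set cs) \<union> {last cs}. y choose (a - 1 - card {z \<in> set cs. y < z}))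
    + cascade_sum a cs = M choose a"
  using assms
proof (induction M arbitrary: a cs)
  case (Suc M)
  let ?Y = "\<lambda>M cs. ({last cs..<M} - set cs) \<union> {last cs}"
  obtain c ds where cs: "cs = c # ds" using Suc.prems(2) by (cases cs) auto
  obtain b where a: "a = Suc b" using Suc.prems(4) cs by (cases a) auto
  have le: "z \<le> c" if "z \<in> set cs" for z using that Suc.prems(1) cs by auto
  have last: "last cs \<in> set cs" using Suc.prems(2) by simp
  show ?case
  proof (cases "c = M")
    case False
    then have c: "c < M" using Suc.prems(3) cs by simp
    define w where "w y = y choose (a - 1 - card {z \<in> set cs. y < z})" for y
    have "M \<notin> set cs" "last cs < M" using c le le[OF last] by force+
    then have Y: "?Y (Suc M) cs = insert M (?Y M cs)" "M \<notin> ?Y M cs" by (auto simp: less_Suc_eq)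
    have "{z \<in> set cs. M < z} = {}" using c le by force
    then have "w M = M choose b" unfolding w_def by (simp add: a del: Collect_empty_eq)
    then have "sum w (?Y (Suc M) cs) = (M choose b) + sum w (?Y M cs)"
      unfolding Y(1) by (subst sum.insert) (use Y(2) in simp_all)
    moreover have "sum w (?Y M cs) + cascade_sum a cs = M choose a"
      using Suc.IH[OF Suc.prems(1,2) _ Suc.prems(4)] c cs by (simp add: w_def)
    ultimately show ?thesis unfolding w_def by (simp add: a)
  next
    case True
    show ?thesis
    proof (cases "ds = []")
      case True
      then have Y: "?Y (Suc M) cs = {M}" and e: "{z \<in> set cs. M < z} = {}"
        using cs \<open>c = M\<close> by auto
      have "(\<Sum>y\<in>?Y (Suc M) cs. y choose (a - 1 - card {z \<in> set cs. y < z})) = M choose b"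
        unfolding Y by (simp add: e a)
      then show ?thesis using cs True \<open>c = M\<close> a by simp
    next
      case False
      have less: "z < M" if "z \<in> set ds" for z using that Suc.prems(1) cs True by auto
      have lastds: "last cs = last ds" "last ds < M" using False cs less by auto
      have Y: "?Y (Suc M) cs = ?Y M ds"
        using lastds cs True by (auto simp: less_Suc_eq)
      have "card {z \<in> set cs. y < z} = Suc (card {z \<in> set ds. y < z})" if "y \<in> ?Y M ds" for y
      proof -
        have "y < M" using that lastds by auto
        then have "{z \<in> set cs. y < z} = insert M {z \<in> set ds. y < z}" using cs True by auto
        moreover have "M \<notin> {z \<in> set ds. y < z}" using less by blast
        ultimately show ?thesis by simp
      qed
      then have "(\<Sum>y\<in>?Y (Suc M) cs. y choose (a - 1 - card {z \<in> set cs. y < z}))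
        = (\<Sum>y\<in>?Y M ds. y choose (b - 1 - card {z \<in> set ds. y < z}))"
        unfolding Y by (intro sum.cong) (simp_all add: a)
      moreover have "hd ds < M" using less False by simp
      ultimately show ?thesis
        using Suc.IH[of ds b] Suc.prems cs a True False by simp
    qed
  qed
qed simp

text \<open>The position of an element in the sorted list is its rank in the set, so the sum in
  \<open>size_bound\<close> can be reindexed without lists.\<close>

lemma sum_sorted_list_of_set:
  fixes S :: "nat set" and f :: "nat \<Rightarrow> nat \<Rightarrow> nat"
  assumes "finite S"
  shows "(\<Sum>i = 1..card S. f (sorted_list_of_set S ! (i - 1)) i)
    = (\<Sum>x\<in>S. f x (card {y \<in> S. y \<le> x}))"
proof -
  define xs where "xs = sorted_list_of_set S"
  have xs: "sorted xs" "distinct xs" "set xs = S" "length xs = card S"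
    using assms by (simp_all add: xs_def)
  have rank: "card {y \<in> S. y \<le> xs ! j} = Suc j" if "j < card S" for j
  proof -
    have "{y \<in> S. y \<le> xs ! j} = (!) xs ` {..j}"
    proof (intro equalityI subsetI)
      fix y assume y: "y \<in> {y \<in> S. y \<le> xs ! j}"
      then obtain i where i: "i < card S" "y = xs ! i"
        using xs by (metis (no_types, lifting) in_set_conv_nth mem_Collect_eq)
      have "i \<le> j"
      proof (rule ccontr)
        assume "\<not> i \<le> j"
        then have "xs ! j \<le> xs ! i" "xs ! j \<noteq> xs ! i"
          using sorted_nth_mono[OF xs(1), of j i] nth_eq_iff_index_eq[OF xs(2), of j i] i that xs(4)
          by auto
        then show False using y i by simp
      qed
      then show "y \<in> (!) xs ` {..j}" using i by auto
    next
      fix y assume "y \<in> (!) xs ` {..j}"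
      then obtain i where i: "i \<le> j" "y = xs ! i" by auto
      then have "xs ! i \<le> xs ! j" using sorted_nth_mono[OF xs(1) i(1)] that xs(4) by simp
      moreover have "xs ! i \<in> set xs" using i that xs(4) by (intro nth_mem) simp
      ultimately show "y \<in> {y \<in> S. y \<le> xs ! j}" using i(2) xs(3) by simp
    qed
    moreover have "inj_on ((!) xs) {..j}"
      using inj_on_nth[OF xs(2), of "{..j}"] that xs(4) by simp
    ultimately show ?thesis by (simp add: card_image)
  qed
  have "(\<Sum>i = 1..card S. f (xs ! (i - 1)) i) = (\<Sum>j<card S. f (xs ! j) (Suc j))"
    by (simp add: sum.atLeast1_atMost_eq)
  also have "\<dots> = (\<Sum>j<card S. f (xs ! j) (card {y \<in> S. y \<le> xs ! j}))"
    by (intro sum.cong) (simp_all add: rank)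
  also have "\<dots> = (\<Sum>x\<in>S. f x (card {y \<in> S. y \<le> x}))"
    by (rule sum.reindex_bij_betw[OF bij_betw_nth[OF xs(2)]]) (use xs in auto)
  finally show ?thesis by (simp add: xs_def)
qed

text \<open>The bound on \<open>card (S_set n k g)\<close> comes from the last entry:
  \<open>last cs \<ge> n - k - length cs\<close> means \<open>b \<le> k + length cs\<close>, and the
  set has \<open>b - length cs\<close> elements.\<close>

lemma S_set_T_set_cascade:
  assumes n: "n > 2 * k" "3 \<le> k"
    and cs: "is_cascade (n - k - 1) g cs" "hd cs < n - 1"
  defines "b \<equiv> n - last cs"
  shows "b_list n k g = map (\<lambda>c. n - c) cs"
    and "T_set n k g = (\<lambda>c. n - c) ` set cs"
    and "S_set n k g = {b} \<union> ({2..b} - T_set n k g)"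
    and "T_set n k g \<subseteq> {2..b}" and "b \<in> T_set n k g"
    and "card (T_set n k g) = length cs"
    and "card (S_set n k g) \<le> k"
    and "\<And>c. c \<in> set cs \<Longrightarrow> last cs \<le> c \<and> c < n - 1"
proof -
  have ne: "cs \<noteq> []" and sorted: "sorted_wrt (>) cs"
    and last: "last cs \<ge> n - k - 1 + 1 - length cs" and len: "length cs \<le> n - k - 1"
    using cs(1) by (auto simp: is_cascade_def)
  have gpos: "1 \<le> g"
    using is_cascade_hd_bounds[OF cs(1)] zero_less_binomial[of "n - k - 1" "hd cs"] by linarith
  have "cascade (n - k - 1) g = cs"
    by (rule is_cascade_unique[OF is_cascade_cascade cs(1)]) (use n gpos in auto)
  then show bl: "b_list n k g = map (\<lambda>c. n - c) cs" by (simp add: b_list_def)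
  then show T: "T_set n k g = (\<lambda>c. n - c) ` set cs" by (simp add: T_set_def)
  have "last (b_list n k g) = b" using bl ne by (simp add: b_def last_map)
  then show S: "S_set n k g = {b} \<union> ({2..b} - T_set n k g)" by (simp add: S_set_def)
  have bound: "last cs \<le> c \<and> c < n - 1" if "c \<in> set cs" for c
  proof
    obtain d ds where d: "cs = d # ds" using ne by (cases cs) auto
    then have "c \<le> d" using that sorted by auto
    then show "c < n - 1" using cs(2) d by simp
    obtain ds e where e: "cs = ds @ [e]" using ne by (cases cs rule: rev_cases) auto
    then show "last cs \<le> c" using that sorted by (auto simp: sorted_wrt_append)
  qed
  then show "\<And>c. c \<in> set cs \<Longrightarrow> last cs \<le> c \<and> c < n - 1" .
  show Tsub: "T_set n k g \<subseteq> {2..b}" unfolding T b_def using bound by fastforce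
  show bT: "b \<in> T_set n k g" unfolding T b_def using ne by simp
  have "inj_on (\<lambda>c. n - c) (set cs)"
    by (rule inj_onI) (use bound in fastforce)
  moreover have "distinct cs" using sorted by (induction cs) auto
  ultimately show cardT: "card (T_set n k g) = length cs"
    unfolding T by (simp add: card_image distinct_card)
  have "card ({2..b} - T_set n k g) = b - 1 - length cs"
    using Tsub cardT by (subst card_Diff_subset) (auto intro: finite_subset)
  then have "card (S_set n k g) = Suc (b - 1 - length cs)"
    using bT unfolding S by simp
  moreover have "length cs \<le> b - 1"
    using card_mono[OF _ Tsub] cardT by simp
  moreover have "b \<le> k + length cs" "2 \<le> b" using last len n bT Tsub by (auto simp: b_def)
  ultimately show "card (S_set n k g) \<le> k" by simp
qed

text \<open>Under \<open>x = n - y\<close> and the symmetry of binomial coefficients the sum in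
  \<open>size_bound\<close> becomes that of \<open>cascade_sum_complement\<close>. Both it and
  \<open>max_cross\<close> are therefore what \<open>cascade_sum (k - 1) cs\<close> leaves of
  \<open>(n - 1) choose (k - 1)\<close>.\<close>

lemma size_bound_eq_max_cross:
  assumes n: "n > 2 * k" "3 \<le> k"
    and cs: "is_cascade (n - k - 1) g cs" "hd cs < n - 1" "length cs \<le> k - 1"
  shows "size_bound n k g = g + max_cross (n - 1) (k - 1) k g"
proof -
  define b where "b = n - last cs"
  note st = S_set_T_set_cascade[OF n cs(1,2), folded b_def]
  define S T where "S = S_set n k g" and "T = T_set n k g"
  define \<tau> where "\<tau> x = card {y \<in> T. y < x}" for x
  define Y where "Y = ({last cs..<n - 1} - set cs) \<union> {last cs}"
  have ne: "cs \<noteq> []" and sorted: "sorted_wrt (>) cs"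
    using cs(1) by (auto simp: is_cascade_def)
  have lastlt: "last cs < n - 1" using st(8) ne by simp
  have S: "S = {b} \<union> ({2..b} - T)" using st(3) by (simp add: S_def T_def)
  have T: "T \<subseteq> {2..b}" "b \<in> T" "card T = length cs" "T = (\<lambda>c. n - c) ` set cs"
    using st by (simp_all add: T_def)
  have finT: "finite T" using T(4) by simp
  have finS: "finite S" using S by simp
  have b: "2 \<le> b" "b \<le> n" using T by (auto simp: b_def)
  \<comment> \<open>The elements of \<open>S\<close> up to \<open>x\<close> are those of
    \<open>{2..x}\<close> that are not elements of \<open>T\<close> below \<open>x\<close>, so
    \<open>x\<close> has rank \<open>x - 1 - \<tau> x\<close>. This includes \<open>x = b\<close>,
    which lies in both sets.\<close>
  have expo: "(n - x) choose (n - k - card {y \<in> S. y \<le> x} + 1) = (n - x) choose (k - 2 - \<tau> x)"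
    if x: "x \<in> S" for x
  proof -
    have x2: "2 \<le> x" "x \<le> b" using x S b by auto
    have "{y \<in> S. y \<le> x} = {2..x} - {y \<in> T. y < x}"
      using x S T(1,2) by auto
    moreover have sub: "{y \<in> T. y < x} \<subseteq> {2..<x}" using T(1) by auto
    moreover have "{y \<in> T. y < x} \<subseteq> {2..x}" using T(1) by auto
    ultimately have rank: "card {y \<in> S. y \<le> x} = x - 1 - \<tau> x"
      using finT by (simp add: card_Diff_subset \<tau>_def)
    have "\<tau> x \<le> x - 2" unfolding \<tau>_def using card_mono[OF _ sub] by simp
    moreover have "\<tau> x \<le> k - 2"
    proof -
      have "{y \<in> T. y < x} \<subseteq> T - {b}" using x2 by auto
      then have "\<tau> x \<le> card (T - {b})" unfolding \<tau>_def using finT by (intro card_mono) auto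
      then show ?thesis using T(2,3) finT cs(3) by simp
    qed
    moreover have "card {y \<in> S. y \<le> x} \<le> k"
      using card_mono[OF finS, of "{y \<in> S. y \<le> x}"] st(7) by (auto simp: S_def)
    ultimately have "n - k - card {y \<in> S. y \<le> x} + 1 \<le> n - x"
      "n - x - (n - k - card {y \<in> S. y \<le> x} + 1) = k - 2 - \<tau> x"
      using rank x2 b n by linarith+
    then show ?thesis using binomial_symmetric by metis
  qed
  have "S = (\<lambda>y. n - y) ` Y"
  proof (intro equalityI subsetI)
    fix x assume x: "x \<in> S"
    have xb: "2 \<le> x" "x \<le> b" using x S b by auto
    then have "x = n - (n - x)" using b by simp
    moreover have "n - x \<in> Y"
    proof (cases "x = b")
      case True
      then show ?thesis using lastlt by (simp add: Y_def b_def)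
    next
      case False
      then have "x \<notin> T" using x S by auto
      then have "n - x \<notin> set cs" using T(4) \<open>x = n - (n - x)\<close> by blast
      then show ?thesis using xb b lastlt by (auto simp: Y_def b_def)
    qed
    ultimately show "x \<in> (\<lambda>y. n - y) ` Y" by blast
  next
    fix x assume "x \<in> (\<lambda>y. n - y) ` Y"
    then obtain y where y: "y \<in> Y" "x = n - y" by blast
    have ylt: "last cs \<le> y" "y < n - 1" using y(1) lastlt by (auto simp: Y_def)
    show "x \<in> S"
    proof (cases "y = last cs")
      case True
      then show ?thesis using y S by (simp add: b_def)
    next
      case False
      then have "y \<notin> set cs" using y by (auto simp: Y_def)
      have "x \<notin> T"
      proof
        assume "x \<in> T"
        then obtain c where c: "c \<in> set cs" "x = n - c" using T(4) by blast
        then have "c = y" using st(8)[OF c(1)] y(2) ylt by linarith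
        then show False using c(1) \<open>y \<notin> set cs\<close> by simp
      qed
      then show ?thesis using S ylt y(2) by (auto simp: b_def)
    qed
  qed
  moreover have "inj_on (\<lambda>y. n - y) Y"
    using lastlt by (intro inj_onI) (auto simp: Y_def)
  moreover have "\<tau> (n - y) = card {z \<in> set cs. y < z}" if "y \<in> Y" for y
  proof -
    have "y < n - 1" using that lastlt by (auto simp: Y_def)
    then have "{x \<in> T. x < n - y} = (\<lambda>c. n - c) ` {z \<in> set cs. y < z}"
      using T(4) st(8) by fastforce
    moreover have "inj_on (\<lambda>c. n - c) {z \<in> set cs. y < z}"
      using st(8) by (intro inj_onI) fastforce
    ultimately show ?thesis by (simp add: \<tau>_def card_image)
  qed
  moreover have "n - (n - y) = y" if "y \<in> Y" for y using that lastlt by (auto simp: Y_def)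
  ultimately have "(\<Sum>x\<in>S. (n - x) choose (k - 2 - \<tau> x))
    = (\<Sum>y\<in>Y. y choose (k - 1 - 1 - card {z \<in> set cs. y < z}))"
    by (simp add: sum.reindex numeral_2_eq_2)
  then have "(\<Sum>x\<in>S. (n - x) choose (k - 2 - \<tau> x)) + cascade_sum (k - 1) cs = (n - 1) choose (k - 1)"
    using cascade_sum_complement[OF sorted ne cs(2,3)] by (simp add: Y_def)
  moreover have "max_cross (n - 1) (k - 1) k g + cascade_sum (k - 1) cs = (n - 1) choose (k - 1)"
    using max_cross_cascade[OF cs(1,2), of k] n by simp
  moreover have "size_bound n k g = (\<Sum>x\<in>S. (n - x) choose (k - 2 - \<tau> x)) + g"
  proof -
    have "size_bound n k g = (\<Sum>x\<in>S. (n - x) choose (n - k - card {y \<in> S. y \<le> x} + 1)) + g"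
      unfolding size_bound_def a_list_def S_def[symmetric]
      using sum_sorted_list_of_set[OF finS, of "\<lambda>x i. (n - x) choose (n - k - i + 1)"] by simp
    then show ?thesis using expo by simp
  qed
  ultimately show ?thesis by linarith
qed

text \<open>With \<open>i = j + 1\<close> the condition is \<open>n - c > 2 * j + 4\<close>; the
  additive form avoids truncated subtraction.\<close>

lemma b_list_gt_iff:
  "(\<forall>i\<in>{1..length cs}. map (\<lambda>c. n - c) cs ! (i - 1) > 2 * i + 2) \<longleftrightarrow>
     (\<forall>i<length cs. cs ! i + 5 + 2 * i \<le> n)" (is "?L \<longleftrightarrow> ?R")
proof
  assume L: ?L
  show ?R
  proof (intro allI impI)
    fix i assume i: "i < length cs"
    then have "map (\<lambda>c. n - c) cs ! (Suc i - 1) > 2 * Suc i + 2" using L by (intro bspec[OF L]) auto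
    then show "cs ! i + 5 + 2 * i \<le> n" using i by simp
  qed
next
  assume R: ?R
  show ?L
  proof
    fix i assume i: "i \<in> {1..length cs}"
    then obtain j where j: "i = Suc j" "j < length cs" by (cases i) auto
    then have "cs ! j + 5 + 2 * j \<le> n" using R by blast
    then show "map (\<lambda>c. n - c) cs ! (i - 1) > 2 * i + 2" using j by simp
  qed
qed

text \<open>The last entry is at least \<open>n - k - length cs\<close> and at most
  \<open>n - 5 - 2 * (length cs - 1)\<close>, so \<open>length cs + 3 \<le> k\<close>.\<close>

lemma is_cascade_length_le:
  assumes "n > 2 * k" "is_cascade (n - k - 1) g cs" "\<forall>i<length cs. cs ! i + 5 + 2 * i \<le> n"
  shows "length cs \<le> k - 1"
proof -
  have ne: "cs \<noteq> []" and last: "last cs \<ge> n - k - 1 + 1 - length cs"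
    using assms(2) by (auto simp: is_cascade_def)
  then have "last cs + 5 + 2 * (length cs - 1) \<le> n"
    using assms(3) by (simp add: last_conv_nth)
  moreover have "1 \<le> length cs" using ne by (cases cs) auto
  ultimately show ?thesis using last assms(1) by linarith
qed

section \<open>Resistance as tameness of the recursion\<close>

lemma binomial_complement:
  "2 * k < n \<Longrightarrow> 3 \<le> k \<Longrightarrow> (n - 4) choose (n - k - 1) = (n - 4) choose (k - 3)" for n k :: nat
  using binomial_symmetric[of "k - 3" "n - 4"] by simp

text \<open>The state \<open>(n - 4, k - 1, k - 3)\<close> arises from
  \<open>(n - 1, k - 1, k)\<close> by three steps of the first kind, which is how the recursion
  starts for positive numbers below \<open>(n - 4) choose (k - 3)\<close>.\<close>

lemma tame_iff_nth:
  assumes "n > 2 * k" "3 \<le> k" "is_cascade (n - k - 1) g cs" "hd cs < n - 4"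
  shows "tame (n - 4) (k - 1) (k - 3) g \<longleftrightarrow> (\<forall>i<length cs. cs ! i + 5 + 2 * i \<le> n)"
proof -
  have "tame (n - 4) (k - 1) (k - 3) g \<longleftrightarrow>
    (\<forall>i<length cs. k - 3 + cs ! i + 3 + 2 * i \<le> k - 1 + (n - 4))"
    by (rule tame_iff_cascade[OF assms(3,4)]) (use assms in simp)
  also have "\<dots> \<longleftrightarrow> (\<forall>i<length cs. cs ! i + 5 + 2 * i \<le> n)"
  proof -
    have "k - 3 + c + 3 + 2 * i \<le> k - 1 + (n - 4) \<longleftrightarrow> c + 5 + 2 * i \<le> n" for c i
      using assms by linarith
    then show ?thesis by simp
  qed
  finally show ?thesis .
qed

text \<open>The condition on the \<open>b_i\<close> is tameness by \<open>tame_iff_nth\<close>.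
  Above \<open>(n - 4) choose (k - 3)\<close> it fails at once, because the leading entry is at
  least \<open>n - 4\<close>.\<close>

lemma resistant_iff:
  assumes n: "n > 2 * k" "3 \<le> k"
  shows "resistant n k g \<longleftrightarrow> g = (n - 4) choose (k - 3) \<or>
    0 < g \<and> g < (n - 4) choose (k - 3) \<and> tame (n - 4) (k - 1) (k - 3) g"
proof (cases "g = (n - 4) choose (k - 3) \<or> g = 0")
  case True
  have "0 < (n - 4) choose (k - 3)" using n by simp
  then show ?thesis using True by (auto simp: resistant_def)
next
  case False
  then have "1 \<le> n - k - 1" "1 \<le> g" using n by simp_all
  then obtain cs where cs: "is_cascade (n - k - 1) g cs" using is_cascade_exists by blast
  have bl: "b_list n k g = map (\<lambda>c. n - c) cs"
    unfolding b_list_def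
    using is_cascade_unique[OF is_cascade_cascade cs] False n by simp
  have cond2: "(\<forall>i\<in>{1..length (b_list n k g)}. b_list n k g ! (i - 1) > 2 * i + 2) \<longleftrightarrow>
      (\<forall>i<length cs. cs ! i + 5 + 2 * i \<le> n)"
    unfolding bl length_map by (rule b_list_gt_iff)
  show ?thesis
  proof (cases "g < (n - 4) choose (k - 3)")
    case True
    have hd: "hd cs < n - 4"
      by (rule is_cascade_hd_less[OF cs]) (use True binomial_complement[OF n] in simp)
    then have hd': "hd cs < n - 1" by simp
    have "card (S_set n k g) \<le> k" "card (T_set n k g) = length cs"
      by (rule S_set_T_set_cascade[OF n cs hd'])+
    then show ?thesis
      using False True cond2 tame_iff_nth[OF n cs hd] is_cascade_length_le[OF n(1) cs]
      unfolding resistant_def by auto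
  next
    case nless: False
    have "\<not> (\<forall>i<length cs. cs ! i + 5 + 2 * i \<le> n)"
    proof
      assume *: "\<forall>i<length cs. cs ! i + 5 + 2 * i \<le> n"
      have "cs \<noteq> []" using cs by auto
      then have "Suc (hd cs) \<le> n - 4" using *[rule_format, of 0] by (simp add: hd_conv_nth)
      then have "Suc (hd cs) choose (n - k - 1) \<le> (n - 4) choose (n - k - 1)"
        by (rule binomial_right_mono)
      then show False
        using is_cascade_hd_bounds[OF cs] nless binomial_complement[OF n] by simp
    qed
    then show ?thesis using False nless cond2 unfolding resistant_def by auto
  qed
qed

lemma resistant_le:
  "n > 2 * k \<Longrightarrow> 3 \<le> k \<Longrightarrow> resistant n k g \<Longrightarrow> g \<le> (n - 4) choose (k - 3)"
  by (auto simp: resistant_iff)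

lemma size_bound_resistant:
  assumes n: "n > 2 * k" "3 \<le> k" and r: "resistant n k g"
  shows "size_bound n k g = g + max_cross (n - 1) (k - 1) k g"
proof (cases "g = (n - 4) choose (k - 3)")
  case True
  \<comment> \<open>The number that is resistant by convention has a one-term cascade, so the
    general formula covers it too.\<close>
  then have "is_cascade (n - k - 1) g [n - 4]"
    unfolding is_cascade_single using n binomial_complement[OF n] by auto
  then show ?thesis by (rule size_bound_eq_max_cross[OF n]) (use n in auto)
next
  case False
  then have g: "0 < g" "g < (n - 4) choose (k - 3)" "tame (n - 4) (k - 1) (k - 3) g"
    using r resistant_iff[OF n] by auto
  then have "1 \<le> n - k - 1" "1 \<le> g" using n by simp_all
  then obtain cs where cs: "is_cascade (n - k - 1) g cs" using is_cascade_exists by blast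
  have hd: "hd cs < n - 4"
    by (rule is_cascade_hd_less[OF cs]) (use g binomial_complement[OF n] in simp)
  have "length cs \<le> k - 1"
    using is_cascade_length_le[OF n(1) cs] tame_iff_nth[OF n cs hd] g(3) by blast
  then show ?thesis using size_bound_eq_max_cross[OF n cs] hd by simp
qed

text \<open>The three steps contribute the \<open>(k - 1)\<close>-sets that meet three fixed
  elements. Their number is a difference of two binomial coefficients, kept in additive
  form.\<close>

lemma max_cross_three_left:
  assumes n: "n > 2 * k" "3 \<le> k" and g: "g \<le> (n - 4) choose (k - 3)"
  shows "max_cross (n - 1) (k - 1) k g + ((n - 4) choose (k - 1))
    = ((n - 1) choose (k - 1)) + max_cross (n - 4) (k - 1) (k - 3) g"
proof -
  define N K where "N = n - 4" and "K = k - 3"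
  then have NK: "n = N + 4" "k = K + 3" using n by simp_all
  have g0: "g \<le> N choose K" using g NK by simp
  then have g1: "g \<le> Suc N choose Suc K" by simp
  then have g2: "g \<le> Suc (Suc N) choose Suc (Suc K)" by simp
  have N: "2 * K + 3 \<le> N" using n NK by simp
  have "max_cross (Suc (Suc (Suc N))) (Suc (Suc K)) (Suc (Suc (Suc K))) g
    = (Suc (Suc N) choose Suc K) + ((Suc N choose Suc K) + ((N choose Suc K)
      + max_cross N (Suc (Suc K)) K g))"
    using max_cross_left[OF _ g2] max_cross_left[OF _ g1] max_cross_left[OF _ g0] N by simp
  then show ?thesis by (simp add: NK eval_nat_numeral)
qed

section \<open>Monotonicity between and along resistant numbers\<close>

text \<open>The jumps of \<open>exists_larger_of_not_tame\<close> are repeated until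
  \<open>r\<close> is reached. None passes over \<open>r\<close>, since a jump passes only over
  numbers that are not tame, while \<open>r\<close> is tame or the largest resistant number.\<close>

lemma size_add_le_of_no_resistant_between:
  assumes n: "n > 2 * k" "3 \<le> k" and "resistant n k r" "0 < g" "g \<le> r"
    "\<And>x. g \<le> x \<Longrightarrow> x < r \<Longrightarrow> \<not> resistant n k x"
  shows "g + max_cross (n - 1) (k - 1) k g \<le> r + max_cross (n - 1) (k - 1) k r"
  using assms(4-)
proof (induction "r - g" arbitrary: g rule: less_induct)
  case less
  let ?C = "(n - 4) choose (k - 3)"
  have rC: "r \<le> ?C" using resistant_le[OF n assms(3)] .
  show ?case
  proof (cases "g = r")
    case False
    then have gr: "g < r" using less.prems by simp
    have "\<not> tame (n - 4) (k - 1) (k - 3) g"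
      using less.prems(3)[of g] gr rC less.prems(1) resistant_iff[OF n] by auto
    moreover have "k - 3 < k - 1" "k - 1 + (k - 3) \<le> n - 4" "g < ?C" using n gr rC by linarith+
    ultimately obtain g' where g': "g < g'" "g' \<le> ?C"
      "\<forall>x. g \<le> x \<longrightarrow> x < g' \<longrightarrow> \<not> tame (n - 4) (k - 1) (k - 3) x"
      "g + max_cross (n - 4) (k - 1) (k - 3) g \<le> g' + max_cross (n - 4) (k - 1) (k - 3) g'"
      using exists_larger_of_not_tame by blast
    have "g' \<le> r"
    proof (rule ccontr)
      assume "\<not> g' \<le> r"
      then have "\<not> tame (n - 4) (k - 1) (k - 3) r" "r < ?C" using g' gr by auto
      then show False using assms(3) resistant_iff[OF n] by auto
    qed
    then have "g' + max_cross (n - 1) (k - 1) k g' \<le> r + max_cross (n - 1) (k - 1) k r"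
      using less.hyps[of g'] less.prems g'(1) gr by simp
    moreover have "g + max_cross (n - 1) (k - 1) k g \<le> g' + max_cross (n - 1) (k - 1) k g'"
      using max_cross_three_left[OF n, of g] max_cross_three_left[OF n, of g'] g' gr rC by simp
    ultimately show ?thesis by simp
  qed simp
qed

lemma size_bound_strict_decreasing:
  assumes n: "n > 2 * k" "3 \<le> k" and r: "resistant n k g" "resistant n k g'" "g < g'"
  shows "size_bound n k g' < size_bound n k g"
proof -
  have le: "g' \<le> (n - 4) choose (k - 3)" by (rule resistant_le[OF n r(2)])
  have "tame (n - 4) (k - 1) (k - 3) g" using resistant_iff[OF n] r(1,3) le by auto
  then have "g' + max_cross (n - 4) (k - 1) (k - 3) g' < g + max_cross (n - 4) (k - 1) (k - 3) g"
    using r(2) resistant_iff[OF n] n by (intro max_cross_add_strict_decreasing r(3) le) auto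
  then show ?thesis
    using max_cross_three_left[OF n, of g] max_cross_three_left[OF n, of g'] r(3) le
    by (simp add: size_bound_resistant[OF n] r)
qed

section \<open>The upper bound for intersecting families\<close>

lemma intersecting_card_le:
  assumes n: "n > 2 * k" "3 \<le> k" and F: "F \<subseteq> k_subsets n k" "intersecting F"
    and div: "diversity n F \<le> (n - 4) choose (k - 3)"
  shows "card F \<le> diversity n F + max_cross (n - 1) (k - 1) k (diversity n F)"
proof -
  have "Max (degree F ` {1..n}) \<in> degree F ` {1..n}" by (rule Max_in) (use n in auto)
  then obtain e where e: "e \<in> {1..n}" "degree F e = max_degree n F"
    by (auto simp: max_degree_def)
  have finF: "finite F"
    by (rule finite_subset[OF F(1)]) (simp add: k_subsets_def)
  let ?X = "{1..n} - {e}"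
  define \<A> where "\<A> = (\<lambda>A. A - {e}) ` {A \<in> F. e \<in> A}"
  define \<B> where "\<B> = {B \<in> F. e \<notin> B}"
  have "inj_on (\<lambda>A. A - {e}) {A \<in> F. e \<in> A}" by (intro inj_onI) blast
  then have cardA: "card \<A> = degree F e" by (simp add: \<A>_def card_image degree_def)
  have "F = {A \<in> F. e \<in> A} \<union> \<B>" by (auto simp: \<B>_def)
  then have "card F = card {A \<in> F. e \<in> A} + card \<B>"
    using card_Un_disjoint[of "{A \<in> F. e \<in> A}" \<B>] finF by (auto simp: \<B>_def)
  then have cardF: "card F = card \<A> + card \<B>" using cardA by (simp add: degree_def)
  then have divB: "diversity n F = card \<B>" using cardA e(2) by (simp add: diversity_def)
  have "card \<A> \<le> max_cross (n - 1) (k - 1) k (card \<B>)"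
  proof (rule cross_intersecting_card_le[of ?X])
    show "card ?X = n - 1" using e by simp
    show "\<A> \<subseteq> {A. A \<subseteq> ?X \<and> card A = k - 1}"
    proof
      fix A assume "A \<in> \<A>"
      then obtain A' where A': "A' \<in> F" "e \<in> A'" "A = A' - {e}" by (auto simp: \<A>_def)
      then have "A' \<subseteq> {1..n}" "card A' = k" using F(1) by (auto simp: k_subsets_def)
      then show "A \<in> {A. A \<subseteq> ?X \<and> card A = k - 1}" using A' by auto
    qed
    show "\<B> \<subseteq> {B. B \<subseteq> ?X \<and> card B = k}" using F(1) by (auto simp: \<B>_def k_subsets_def)
    show "A \<inter> B \<noteq> {}" if "A \<in> \<A>" "B \<in> \<B>" for A B
    proof -
      obtain A' where A': "A' \<in> F" "A = A' - {e}" using \<open>A \<in> \<A>\<close> by (auto simp: \<A>_def)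
      have B: "B \<in> F" "e \<notin> B" using \<open>B \<in> \<B>\<close> by (auto simp: \<B>_def)
      have "A' \<inter> B \<noteq> {}" using F(2) A'(1) B(1) by (simp add: intersecting_def)
      then show ?thesis using A' B by auto
    qed
    \<comment> \<open>The strict inequality arises in the first use of Pascal's rule, where
      \<open>N choose Suc K\<close> is positive.\<close>
    show "card \<B> < (n - 1) choose k"
    proof -
      define N K where "N = n - 4" and "K = k - 3"
      then have NK: "n = Suc (Suc (Suc (Suc N)))" "k = Suc (Suc (Suc K))" using n by simp_all
      have "0 < N choose Suc K" using n NK by simp
      then have "N choose K < Suc N choose Suc K" by simp
      also have "\<dots> \<le> Suc (Suc N) choose Suc (Suc K)" by simp
      also have "\<dots> \<le> Suc (Suc (Suc N)) choose Suc (Suc (Suc K))" by simp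
      finally have "N choose K < (n - 1) choose k" by (simp add: NK del: binomial_Suc_Suc)
      moreover have "card \<B> \<le> N choose K" using div divB NK by simp
      ultimately show ?thesis by simp
    qed
  qed (use n in auto)
  then show ?thesis using cardF divB by simp
qed

section \<open>The extremal families\<close>

text \<open>The element 1 is the centre, and every set avoiding it contains 2, 3 and 4; the rest is
  an extremal cross-intersecting pair on \<open>{5..n}\<close>. The three common elements make the
  sets avoiding 1 intersect and also give 1 the maximal degree.\<close>

lemma exists_extremal_family:
  assumes n: "n > 2 * k" "3 \<le> k" and g: "g \<le> (n - 4) choose (k - 3)"
  shows "\<exists>F. F \<subseteq> k_subsets n k \<and> intersecting F \<and> diversity n F = g \<and>
    card F = g + max_cross (n - 1) (k - 1) k g"
proof -
  have cX: "card {5..n} = n - 4" by simp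
  have "\<exists>\<A> \<B>. \<A> \<subseteq> {A. A \<subseteq> {5..n} \<and> card A = k - 1} \<and> \<B> \<subseteq> {B. B \<subseteq> {5..n} \<and> card B = k - 3} \<and>
    (\<forall>A\<in>\<A>. \<forall>B\<in>\<B>. A \<inter> B \<noteq> {}) \<and> card \<A> = max_cross (n - 4) (k - 1) (k - 3) g \<and> card \<B> = g"
    by (rule cross_intersecting_exists[OF _ cX _ g]) (use n in auto)
  then obtain \<A> \<B> where AB: "\<A> \<subseteq> {A. A \<subseteq> {5..n} \<and> card A = k - 1}"
    "\<B> \<subseteq> {B. B \<subseteq> {5..n} \<and> card B = k - 3}" "\<forall>A\<in>\<A>. \<forall>B\<in>\<B>. A \<inter> B \<noteq> {}"
    "card \<A> = max_cross (n - 4) (k - 1) (k - 3) g" "card \<B> = g" by blast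
  \<comment> \<open>These sets meet every member of \<open>B2\<close> already inside
    \<open>{2,3,4}\<close>.\<close>
  define \<D> where "\<D> = {A. A \<subseteq> {2..n} \<and> card A = k - 1 \<and> A \<inter> {2,3,4} \<noteq> {}}"
  define A2 where "A2 = \<A> \<union> \<D>"
  define B2 where "B2 = (\<lambda>B. B \<union> {2,3,4}) ` \<B>"
  define F where "F = insert 1 ` A2 \<union> B2"
  have A2sub: "A \<subseteq> {2..n} \<and> card A = k - 1" if "A \<in> A2" for A
    using that AB(1) by (fastforce simp: A2_def \<D>_def)
  have fin1: "finite A2"
    by (rule finite_subset[of _ "Pow {2..n}"]) (use A2sub in auto)
  have finB: "finite \<B>" by (rule finite_subset[OF AB(2)]) simp
  have B2sub: "B \<subseteq> {2..n} \<and> card B = k \<and> {2,3,4} \<subseteq> B" if B: "B \<in> B2" for B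
  proof -
    obtain B' where B': "B' \<in> \<B>" "B = B' \<union> {2,3,4}" using B unfolding B2_def by blast
    have b: "B' \<subseteq> {5..n}" "card B' = k - 3" using AB(2) B'(1) by auto
    have "card (B' \<union> {2,3,4}) = card B' + card {2,3,4::nat}"
      using b(1) finite_subset[OF b(1)] by (intro card_Un_disjoint) auto
    then have "card B = k" using b B' n by simp
    moreover have "B \<subseteq> {2..n}" using b B' n by force
    ultimately show ?thesis using B' by simp
  qed
  have fin2: "finite B2" using finB by (simp add: B2_def)
  have "inj_on (\<lambda>B. B \<union> {2,3,4}) \<B>"
  proof (rule inj_onI)
    fix B C assume "B \<in> \<B>" "C \<in> \<B>" and eq: "B \<union> {2,3,4} = C \<union> {2,3,4}"
    then have "B \<subseteq> {5..n}" "C \<subseteq> {5..n}" using AB(2) by blast+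
    then have "B \<inter> {2,3,4} = {}" "C \<inter> {2,3,4} = {}" by auto
    then show "B = C" using eq by blast
  qed
  then have cardB2: "card B2 = g" using AB(5) by (simp add: B2_def card_image)
  have not1: "1 \<notin> A" if "A \<in> A2 \<union> B2" for A using that A2sub B2sub by fastforce
  have cardA2: "card A2 = max_cross (n - 1) (k - 1) k g"
  proof -
    have c2: "card {2..n} = n - 1" by simp
    have "card {A. A \<subseteq> {2..n} \<and> card A = k - 1} = (n - 1) choose (k - 1)"
      using n_subsets[of "{2..n}" "k - 1"] c2 by simp
    moreover have "card {A. A \<subseteq> {5..n} \<and> card A = k - 1} = (n - 4) choose (k - 1)"
      using n_subsets[of "{5..n}" "k - 1"] cX by simp
    moreover have split: "{A. A \<subseteq> {2..n} \<and> card A = k - 1} = \<D> \<union> {A. A \<subseteq> {5..n} \<and> card A = k - 1}"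
    proof (intro equalityI subsetI)
      fix A assume A: "A \<in> {A. A \<subseteq> {2..n} \<and> card A = k - 1}"
      show "A \<in> \<D> \<union> {A. A \<subseteq> {5..n} \<and> card A = k - 1}"
      proof (cases "A \<inter> {2,3,4} = {}")
        case True
        have "A \<subseteq> {5..n}"
        proof
          fix x assume x: "x \<in> A"
          then have "x \<noteq> 2" "x \<noteq> 3" "x \<noteq> 4" using True by auto
          moreover have "2 \<le> x" "x \<le> n" using A x by auto
          ultimately show "x \<in> {5..n}" by simp
        qed
        then show ?thesis using A by simp
      qed (use A in \<open>simp add: \<D>_def\<close>)
    qed (auto simp: \<D>_def)
    moreover have disj: "\<D> \<inter> {A. A \<subseteq> {5..n} \<and> card A = k - 1} = {}"
      by (auto simp: \<D>_def)
    moreover have finD: "finite \<D>" by (simp add: \<D>_def)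
    ultimately have "card \<D> + ((n - 4) choose (k - 1)) = (n - 1) choose (k - 1)"
      using card_Un_disjoint[OF finD _ disj] by simp
    moreover have "card A2 = card \<A> + card \<D>"
      unfolding A2_def using AB(1) disj finD
      by (intro card_Un_disjoint finite_subset[OF AB(1)]) auto
    ultimately show ?thesis using AB(4) max_cross_three_left[OF n g] by simp
  qed
  have injA2: "inj_on (insert 1) A2" by (rule inj_on_insert_of_notin) (use not1 in auto)
  have with1: "{A \<in> F. 1 \<in> A} = insert 1 ` A2" using not1 by (auto simp: F_def)
  then have deg1: "degree F 1 = card A2" unfolding degree_def by (simp only: card_image[OF injA2])
  have finF: "finite F" using fin1 fin2 by (simp add: F_def)
  have Fsub: "F \<subseteq> k_subsets n k"
  proof
    fix A assume "A \<in> F"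
    then consider A' where "A' \<in> A2" "A = insert 1 A'" | "A \<in> B2" by (auto simp: F_def)
    then show "A \<in> k_subsets n k"
    proof cases
      case 1
      have a: "A' \<subseteq> {2..n}" "card A' = k - 1" "1 \<notin> A'" using A2sub not1 1 by auto
      then have "card A = k" using 1 n finite_subset[OF a(1)] by simp
      moreover have "A \<subseteq> {1..n}" using 1 a n by force
      ultimately show ?thesis by (simp add: k_subsets_def)
    next
      case 2
      then show ?thesis using B2sub[OF 2] by (force simp: k_subsets_def)
    qed
  qed
  have cross: "A \<inter> B \<noteq> {}" if A: "A \<in> A2" and B: "B \<in> B2" for A B
  proof (cases "A \<in> \<A>")
    case True
    obtain B' where "B' \<in> \<B>" "B = B' \<union> {2,3,4}" using B unfolding B2_def by blast
    then show ?thesis using AB(3) True by blast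
  next
    case False
    then have "A \<inter> {2,3,4} \<noteq> {}" using A by (simp add: A2_def \<D>_def)
    then show ?thesis using B2sub[OF B] by blast
  qed
  have inter: "intersecting F"
    unfolding intersecting_def
  proof (intro ballI)
    fix A B assume "A \<in> F" "B \<in> F"
    then consider "1 \<in> A" "1 \<in> B" | A' where "A' \<in> A2" "A' \<subseteq> A" "B \<in> B2"
      | B' where "B' \<in> A2" "B' \<subseteq> B" "A \<in> B2" | "A \<in> B2" "B \<in> B2"
      unfolding F_def by blast
    then show "A \<inter> B \<noteq> {}"
    proof cases
      case 2
      then show ?thesis using cross[of A' B] by blast
    next
      case 3
      then show ?thesis using cross[of B' A] by blast
    next
      case 4
      then show ?thesis using B2sub[of A] B2sub[of B] by blast
    qed blast
  qed
  have deg: "degree F i \<le> degree F 1" if "i \<in> {1..n}" for i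
  proof (cases "i = 1")
    case False
    let ?P = "{A \<in> F. 1 \<in> A \<and> i \<in> A}" and ?Q = "{A \<in> F. 1 \<notin> A \<and> i \<in> A}"
      and ?R = "{A \<in> F. 1 \<in> A \<and> i \<notin> A}"
    \<comment> \<open>Replacing \<open>i\<close> by 1 stays in \<open>F\<close>: at least two of 2,
      3, 4 survive the deletion of \<open>i\<close>, so the remaining set is in
      \<open>\<D>\<close>.\<close>
    have "card ?Q \<le> card ?R"
    proof (rule card_inj_on_le)
      show "inj_on (\<lambda>A. insert 1 (A - {i})) ?Q"
      proof (rule inj_onI)
        fix A B assume "A \<in> ?Q" "B \<in> ?Q" and eq: "insert 1 (A - {i}) = insert 1 (B - {i})"
        then have i: "1 \<notin> A" "1 \<notin> B" "i \<in> A" "i \<in> B" by auto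
        then have "A = insert i (insert 1 (A - {i}) - {1})" by auto
        also have "\<dots> = insert i (insert 1 (B - {i}) - {1})" by (simp only: eq)
        also have "\<dots> = B" using i by auto
        finally show "A = B" .
      qed
      show "(\<lambda>A. insert 1 (A - {i})) ` ?Q \<subseteq> ?R"
      proof (rule image_subsetI)
        fix A assume "A \<in> ?Q"
        then have A: "A \<in> B2" "i \<in> A" by (auto simp: F_def)
        have a: "A \<subseteq> {2..n}" "card A = k" "{2,3,4} \<subseteq> A" using B2sub[OF A(1)] by auto
        have "A - {i} \<in> \<D>"
        proof -
          have "2 \<in> A - {i} \<or> 3 \<in> A - {i}" using a(3) by auto
          then have "(A - {i}) \<inter> {2,3,4} \<noteq> {}" by blast
          moreover have "card (A - {i}) = k - 1" using A a by simp
          ultimately show ?thesis using a(1) by (auto simp: \<D>_def)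
        qed
        then show "insert 1 (A - {i}) \<in> ?R" using False by (auto simp: F_def A2_def)
      qed
    qed (use finF in simp)
    moreover have "{A \<in> F. i \<in> A} = ?P \<union> ?Q" "{A \<in> F. 1 \<in> A} = ?P \<union> ?R" by auto
    moreover have "card (?P \<union> ?Q) = card ?P + card ?Q" "card (?P \<union> ?R) = card ?P + card ?R"
      using finF by (intro card_Un_disjoint; auto)+
    ultimately show ?thesis by (simp add: degree_def)
  qed simp
  have "Max (degree F ` {1..n}) = degree F 1"
    by (rule Max_eqI) (use deg n in auto)
  then have maxdeg: "max_degree n F = card A2" unfolding max_degree_def deg1 .
  have "card F = card (insert 1 ` A2) + card B2"
    unfolding F_def using fin1 fin2 not1 by (intro card_Un_disjoint) auto
  then have "card F = card A2 + g" using card_image[OF injA2] cardB2 by simp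
  then show ?thesis using Fsub inter maxdeg cardA2
    by (intro exI[of _ F]) (simp add: diversity_def)
qed

section \<open>Bound, strict decrease and sharpness along the enumeration of resistant
  numbers\<close>

theorem theorem6:
  fixes n k m :: nat and \<gamma> :: "nat \<Rightarrow> nat"
  assumes "n > 2 * k" and "2 * k \<ge> 6"
    and "\<gamma> 0 = 0"
    and "strict_mono_on {1..m} \<gamma>"
    and "\<gamma> ` {1..m} = {g. resistant n k g}"
  shows "(\<forall>F l. F \<subseteq> k_subsets n k \<longrightarrow> intersecting F \<longrightarrow> l \<in> {1..m} \<longrightarrow>
             \<gamma> (l - 1) < diversity n F \<longrightarrow> diversity n F \<le> \<gamma> l \<longrightarrow>
             card F \<le> size_bound n k (\<gamma> l))
       \<and> (\<forall>l\<in>{1..m}. \<forall>l'\<in>{1..m}. l < l' \<longrightarrow> size_bound n k (\<gamma> l') < size_bound n k (\<gamma> l))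
       \<and> (\<forall>l\<in>{1..m}. \<exists>F. F \<subseteq> k_subsets n k \<and> intersecting F \<and>
             diversity n F = \<gamma> l \<and> card F = size_bound n k (\<gamma> l))"
proof (intro conjI allI impI ballI)
  have n: "n > 2 * k" "3 \<le> k" using assms(1,2) by auto
  have res: "resistant n k (\<gamma> l)" if "l \<in> {1..m}" for l using that assms(5) by blast
  show "card F \<le> size_bound n k (\<gamma> l)"
    if F: "F \<subseteq> k_subsets n k" "intersecting F" and l: "l \<in> {1..m}"
      and div: "\<gamma> (l - 1) < diversity n F" "diversity n F \<le> \<gamma> l" for F l
  proof -
    let ?d = "diversity n F"
    have "?d \<le> (n - 4) choose (k - 3)" using div(2) resistant_le[OF n res[OF l]] by simp
    then have "card F \<le> ?d + max_cross (n - 1) (k - 1) k ?d" by (rule intersecting_card_le[OF n F])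
    also have "\<dots> \<le> \<gamma> l + max_cross (n - 1) (k - 1) k (\<gamma> l)"
    proof (rule size_add_le_of_no_resistant_between[OF n res[OF l] _ div(2)])
      fix x assume x: "?d \<le> x" "x < \<gamma> l"
      \<comment> \<open>A resistant \<open>x\<close> would be \<open>\<gamma> j\<close> for some
        \<open>j\<close> with \<open>1 \<le> j < l\<close>, hence at most
        \<open>\<gamma> (l - 1)\<close>, which is below the diversity.\<close>
      show "\<not> resistant n k x"
      proof
        assume "resistant n k x"
        then obtain j where j: "j \<in> {1..m}" "x = \<gamma> j" using assms(5) by blast
        have "j < l"
          using strict_mono_on_less[OF assms(4) j(1) l] x(2) j(2) by simp
        then have "l - 1 \<in> {1..m}" "j \<le> l - 1" using j l by auto
        then have "\<gamma> j \<le> \<gamma> (l - 1)"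
          using strict_mono_on_less_eq[OF assms(4) j(1)] by blast
        then show False using div(1) x(1) j(2) by simp
      qed
    qed (use div(1) in simp)
    finally show ?thesis by (simp add: size_bound_resistant[OF n res[OF l]])
  qed
  show "size_bound n k (\<gamma> l') < size_bound n k (\<gamma> l)"
    if "l \<in> {1..m}" "l' \<in> {1..m}" "l < l'" for l l'
    using strict_mono_onD[OF assms(4) that] by (intro size_bound_strict_decreasing n res that)
  show "\<exists>F. F \<subseteq> k_subsets n k \<and> intersecting F \<and> diversity n F = \<gamma> l \<and>
      card F = size_bound n k (\<gamma> l)" if "l \<in> {1..m}" for l
    using exists_extremal_family[OF n resistant_le[OF n res[OF that]]]
    by (simp add: size_bound_resistant[OF n res[OF that]])
qed

end
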